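(* Let $(A,\alpha)$ be a Hom-left-symmetric conformal algebra and $r=\sum_ir_i\otimes l_i\in A\otimes A$. Assume that $\alpha^{\otimes2}(r)=r$. Define a map $\delta:A\to A\otimes A$ by $$\delta(a)=(L_A(a)\otimes\alpha+\alpha\otimes ad_A(a))_\lambda r\big|_{\lambda=-\partial^{\otimes2}}=\sum_i\big(a_\lambda r_i\otimes\alpha(l_i)+\alpha(r_i)\otimes[a_\lambda l_i]\big)\big|_{\lambda=-\partial^{\otimes2}},\qquad a\in A.$$ Then $(A,\delta,\alpha)$ is a Hom-left-symmetric conformal coalgebra if and only if $J_\delta(a)=0$ for all $a\in A$, where $$J_\delta(a)=\alpha^{\otimes3}\big(Q(a)_\lambda[[r,r]]\big|_{\lambda=-\partial^{\otimes3}}\big)+M(a),$$ with $Q$, $[[r,r]]$ and $M$ given by $$Q(x)_\lambda=L_A(x)_\lambda\otimes\alpha\otimes\alpha+\alpha\otimes L_A(x)_\lambda\otimes\alpha+\alpha\otimes\alpha\otimes ad_A(x)_\lambda,$$ $$[[r,r]]=\sum_{i,j}(r_{i\,\mu}r_j\otimes\alpha(l_j)\otimes\alpha(l_i))|_{\mu=1\otimes1\otimes\partial}-\sum_{i,j}(\alpha(l_j)\otimes r_{i\,\mu}r_j\otimes\alpha(l_i))|_{\mu=1\otimes1\otimes\partial}-\sum_{i,j}(\alpha(r_j)\otimes[l_{j\,\mu}r_i]\otimes\alpha(l_i))|_{\mu=\partial\otimes1\otimes1}$$ $$\qquad+\sum_{i,j}([l_{j\,\mu}r_i]\otimes\alpha(r_j)\otimes\alpha(l_i))|_{\mu=1\otimes\partial\otimes1}-\sum_{i,j}(\alpha(r_i)\otimes\alpha(r_j)\otimes[l_{i\,\mu}l_j])|_{\mu=\partial\otimes1\otimes1},$$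 $$M(a)=\sum_jP(a_\lambda r_j)_\mu(r_{12}-r_{21})\otimes\alpha^2(l_j)\big|_{\lambda=-\partial^{\otimes3},\,\mu=-\partial^{\otimes2}\otimes1}-\sum_jP(\alpha(a))_\lambda\big(P(r_j)_\mu(r_{12}-r_{21})\big)\otimes\alpha^2(l_j)\big|_{\lambda=-\partial^{\otimes3},\,\mu=1\otimes1\otimes\partial},$$ where $P(x)_\lambda=L_A(x)_\lambda\otimes\alpha+\alpha\otimes L_A(x)_\lambda$, $r_{12}=\sum_ir_i\otimes l_i$ and $r_{21}=\sum_il_i\otimes r_i$.
   Context: Everything is over $\mathbb C$. Convention: if $x_\lambda y=\sum_n\lambda^n z_n$, then $x_{-\lambda-\partial}y=\sum_n(-\lambda-\partial)^n z_n$. A substitution such as $|_{\mu=1\otimes1\otimes\partial}$ means: expand the tensor expression in powers of $\mu$ and replace $\mu^n$ by the $n$-th power of the indicated operator applied to the tensor coefficient (and similarly for $\lambda$). Notation: $\partial^{\otimes2}=\partial\otimes1+1\otimes\partial$, $\partial^{\otimes3}=\partial\otimes1\otimes1+1\otimes\partial\otimes1+1\otimes1\otimes\partial$, $\alpha^{\otimes2}=\alpha\otimes\alpha$, $\alpha^{\otimes3}=\alpha\otimes\alpha\otimes\alpha$. $\mathbb C[\partial]$ acts on $A\otimes A$ via $\partial^{\otimes2}$. A Hom-left-symmetric conformal algebra $(A,\alpha)$ is a $\mathbb C[\partial]$-module $A$ with a linear map $\alpha:A\to A$, $\alpha\partial=\partial\alpha$, and a $\mathbb C$-linear map $A\otimes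 A\to\mathbb C[\lambda]\otimes A$, $a\otimes b\mapsto a_\lambda b$, such that: $(\partial a)_\lambda b=-\lambda\,a_\lambda b$, $a_\lambda(\partial b)=(\partial+\lambda)(a_\lambda b)$, $\alpha(a_\lambda b)=\alpha(a)_\lambda\alpha(b)$, and $$(a_\lambda b)_{\lambda+\mu}\alpha(c)-\alpha(a)_\lambda(b_\mu c)=(b_\mu a)_{\lambda+\mu}\alpha(c)-\alpha(b)_\mu(a_\lambda c).$$ Put $[a_\lambda b]=a_\lambda b-b_{-\lambda-\partial}a$, $L_A(a)_\lambda b=a_\lambda b$, $ad_A(a)_\lambda b=[a_\lambda b]$. A Hom-left-symmetric conformal coalgebra $(A,\Delta,\alpha)$ is a $\mathbb C[\partial]$-module $A$ with a linear map $\alpha:A\to A$, $\alpha\partial=\partial\alpha$, and a $\mathbb C[\partial]$-module homomorphism $\Delta:A\to A\otimes A$ such that for all $x\in A$ $$(\alpha\otimes\Delta)\Delta(x)-\tau_{12}(\alpha\otimes\Delta)\Delta(x)=(\Delta\otimes\alpha)\Delta(x)-\tau_{12}(\Delta\otimes\alpha)\Delta(x),$$ where $\tau_{12}(x\otimes y\otimes z)=y\otimes x\otimes z$. *)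

theory Defs
  imports Complex_Main "HOL-Library.Poly_Mapping" "HOL-Computational_Algebra.Polynomial"
begin

section \<open>Complex vector spaces\<close>

class complex_vector = ab_group_add +
  fixes scaleC :: "complex \<Rightarrow> 'a \<Rightarrow> 'a"  (infixr "*\<^sub>C" 75)
  assumes scaleC_add_right: "c *\<^sub>C (x + y) = c *\<^sub>C x + c *\<^sub>C y"
    and scaleC_add_left: "(c + d) *\<^sub>C x = c *\<^sub>C x + d *\<^sub>C x"
    and scaleC_scaleC: "c *\<^sub>C d *\<^sub>C x = (c * d) *\<^sub>C x"
    and scaleC_one: "1 *\<^sub>C x = x"

interpretation complex_vector: vector_space "scaleC :: complex \<Rightarrow> 'a \<Rightarrow> 'a::complex_vector"
  by unfold_locales (simp_all add: scaleC_add_right scaleC_add_left scaleC_scaleC scaleC_one)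

abbreviation clinear :: "('a::complex_vector \<Rightarrow> 'b::complex_vector) \<Rightarrow> bool" where
  "clinear \<equiv> Vector_Spaces.linear scaleC scaleC"

definition cbilinear ::
  "('a::complex_vector \<Rightarrow> 'b::complex_vector \<Rightarrow> 'c::complex_vector) \<Rightarrow> bool" where
  "cbilinear f \<longleftrightarrow> (\<forall>y. clinear (\<lambda>x. f x y)) \<and> (\<forall>x. clinear (f x))"

text \<open>\<open>'a poly\<close> is \<open>\<complex>[\<lambda>] \<otimes> 'a\<close>: polynomials in \<open>\<lambda>\<close> whose coefficients are vectors.\<close>

instantiation poly :: (complex_vector) complex_vector
begin
definition scaleC_poly :: "complex \<Rightarrow> 'a poly \<Rightarrow> 'a poly" where
  "scaleC_poly c p = map_poly (scaleC c) p"
instance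
  by standard (simp_all add: scaleC_poly_def poly_eq_iff coeff_map_poly
      scaleC_add_right scaleC_add_left scaleC_scaleC scaleC_one)
end

instantiation poly_mapping :: (type, complex_vector) complex_vector
begin
lift_definition scaleC_poly_mapping :: "complex \<Rightarrow> ('a \<Rightarrow>\<^sub>0 'b) \<Rightarrow> ('a \<Rightarrow>\<^sub>0 'b)" is
  "\<lambda>c f k. c *\<^sub>C f k"
proof -
  fix c :: complex and f :: "'a \<Rightarrow> 'b"
  assume "finite {k. f k \<noteq> 0}"
  then show "finite {k. c *\<^sub>C f k \<noteq> 0}"
    by (rule rev_finite_subset) auto
qed
instance
  by standard (transfer; simp add: scaleC_add_right scaleC_add_left scaleC_scaleC scaleC_one)+
end

instantiation complex :: complex_vector
begin
definition scaleC_complex :: "complex \<Rightarrow> complex \<Rightarrow> complex" where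
  "scaleC_complex c x = c * x"
instance
  by standard (simp_all add: scaleC_complex_def algebra_simps)
end


section \<open>Tensor products\<close>

text \<open>The free vector space on pairs, modulo the bilinearity relations.\<close>

definition tensor_null :: "('a::complex_vector \<times> 'b::complex_vector \<Rightarrow>\<^sub>0 complex) set" where
  "tensor_null = complex_vector.span
     (  {Poly_Mapping.single (x + x', y) 1 - Poly_Mapping.single (x, y) 1
           - Poly_Mapping.single (x', y) 1 | x x' y. True}
      \<union> {Poly_Mapping.single (x, y + y') 1 - Poly_Mapping.single (x, y) 1
           - Poly_Mapping.single (x, y') 1 | x y y'. True}
      \<union> {Poly_Mapping.single (c *\<^sub>C x, y) 1 - c *\<^sub>C Poly_Mapping.single (x, y) 1 | c x y. True}
      \<union> {Poly_Mapping.single (x, c *\<^sub>C y) 1 - c *\<^sub>C Poly_Mapping.single (x, y) 1 | c x y. True})"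

definition tensor_rel ::
  "('a::complex_vector \<times> 'b::complex_vector \<Rightarrow>\<^sub>0 complex) \<Rightarrow> ('a \<times> 'b \<Rightarrow>\<^sub>0 complex) \<Rightarrow> bool" where
  "tensor_rel p q \<longleftrightarrow> p - q \<in> tensor_null"

lemma tensor_null_zero: "0 \<in> tensor_null"
  unfolding tensor_null_def by (rule complex_vector.span_zero)

lemma tensor_null_add: "p \<in> tensor_null \<Longrightarrow> q \<in> tensor_null \<Longrightarrow> p + q \<in> tensor_null"
  unfolding tensor_null_def by (rule complex_vector.span_add)

lemma tensor_null_diff: "p \<in> tensor_null \<Longrightarrow> q \<in> tensor_null \<Longrightarrow> p - q \<in> tensor_null"
  unfolding tensor_null_def by (rule complex_vector.span_diff)

lemma tensor_null_scale: "p \<in> tensor_null \<Longrightarrow> c *\<^sub>C p \<in> tensor_null"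
  unfolding tensor_null_def by (rule complex_vector.span_scale)

lemma equivp_tensor_rel: "equivp (tensor_rel ::
    ('x::complex_vector \<times> 'y::complex_vector \<Rightarrow>\<^sub>0 complex) \<Rightarrow> _)" (is "equivp ?R")
proof (rule equivpI)
  show "reflp ?R"
    by (rule reflpI) (simp add: tensor_rel_def tensor_null_zero)
  show "symp ?R"
  proof (rule sympI)
    fix p q :: "'x \<times> 'y \<Rightarrow>\<^sub>0 complex"
    assume "tensor_rel p q"
    then show "tensor_rel q p"
      unfolding tensor_rel_def using tensor_null_diff[OF tensor_null_zero, of "p - q"] by simp
  qed
  show "transp ?R"
  proof (rule transpI)
    fix p q s :: "'x \<times> 'y \<Rightarrow>\<^sub>0 complex"
    assume "tensor_rel p q" "tensor_rel q s"
    then show "tensor_rel p s"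
      unfolding tensor_rel_def using tensor_null_add[of "p - q" "q - s"] by simp
  qed
qed

quotient_type (overloaded) ('a, 'b) tensor (infixl "\<otimes>" 70) =
  "'a::complex_vector \<times> 'b::complex_vector \<Rightarrow>\<^sub>0 complex" / tensor_rel
  by (rule equivp_tensor_rel)

instantiation tensor :: (complex_vector, complex_vector) complex_vector
begin

lift_definition zero_tensor :: "'a \<otimes> 'b" is 0 .

lift_definition plus_tensor :: "'a \<otimes> 'b \<Rightarrow> 'a \<otimes> 'b \<Rightarrow> 'a \<otimes> 'b" is "(+)"
  unfolding tensor_rel_def by (metis add_diff_add tensor_null_add)

lift_definition minus_tensor :: "'a \<otimes> 'b \<Rightarrow> 'a \<otimes> 'b \<Rightarrow> 'a \<otimes> 'b" is "(-)"
proof -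
  fix p p' q q' :: "'a \<times> 'b \<Rightarrow>\<^sub>0 complex"
  assume "tensor_rel p p'" "tensor_rel q q'"
  then show "tensor_rel (p - q) (p' - q')"
    unfolding tensor_rel_def using tensor_null_diff[of "p - p'" "q - q'"]
    by (simp add: algebra_simps)
qed

lift_definition uminus_tensor :: "'a \<otimes> 'b \<Rightarrow> 'a \<otimes> 'b" is uminus
proof -
  fix p p' :: "'a \<times> 'b \<Rightarrow>\<^sub>0 complex"
  assume "tensor_rel p p'"
  then show "tensor_rel (- p) (- p')"
    unfolding tensor_rel_def using tensor_null_diff[OF tensor_null_zero, of "p - p'"]
    by (simp add: algebra_simps)
qed

lift_definition scaleC_tensor :: "complex \<Rightarrow> 'a \<otimes> 'b \<Rightarrow> 'a \<otimes> 'b" is scaleC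
  unfolding tensor_rel_def
  by (metis complex_vector.scale_right_diff_distrib tensor_null_scale)

instance
  by standard (transfer; simp add: tensor_rel_def tensor_null_zero algebra_simps
      scaleC_add_right scaleC_add_left scaleC_scaleC scaleC_one)+

end

lift_definition tensor :: "'a::complex_vector \<Rightarrow> 'b::complex_vector \<Rightarrow> 'a \<otimes> 'b"  (infixl "\<otimes>" 70)
  is "\<lambda>x y. Poly_Mapping.single (x, y) 1" .

text \<open>The linear map induced by a bilinear one; \<open>ex1_tensor_lift\<close> below is the
  universal property that makes the description proper.\<close>

definition tensor_lift ::
  "('a::complex_vector \<Rightarrow> 'b::complex_vector \<Rightarrow> 'c::complex_vector) \<Rightarrow> 'a \<otimes> 'b \<Rightarrow> 'c" where
  "tensor_lift f = (THE h. clinear h \<and> (\<forall>x y. h (x \<otimes> y) = f x y))"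

lemma clinearI:
  assumes "\<And>x y. h (x + y) = h x + h y" and "\<And>c x. h (c *\<^sub>C x) = c *\<^sub>C h x"
  shows "clinear h"
  using assms
  by (auto intro!: Vector_Spaces.linear.intro complex_vector.vector_space_axioms
      simp: module_hom_axioms_def module_hom_def complex_vector.module_axioms)

lemma clinear_add: "clinear h \<Longrightarrow> h (x + y) = h x + h y"
  unfolding Vector_Spaces.linear_def using module_hom.add by blast

lemma clinear_scale: "clinear h \<Longrightarrow> h (c *\<^sub>C x) = c *\<^sub>C h x"
  unfolding Vector_Spaces.linear_def using module_hom.scale by blast

lemma clinear_diff: "clinear h \<Longrightarrow> h (x - y) = h x - h y"
  unfolding Vector_Spaces.linear_def using module_hom.diff by blast

lemma clinear_sum: "clinear h \<Longrightarrow> h (\<Sum>i\<in>S. g i) = (\<Sum>i\<in>S. h (g i))"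
  unfolding Vector_Spaces.linear_def using module_hom.sum by blast

lemma cbilinear_tensor: "cbilinear (tensor :: 'a::complex_vector \<Rightarrow> 'b::complex_vector \<Rightarrow> 'a \<otimes> 'b)"
proof -
  have gen: "p \<in> tensor_null" if "p \<in>
     (  {Poly_Mapping.single (x + x', y) 1 - Poly_Mapping.single (x, y) 1
           - Poly_Mapping.single (x', y) 1 | x x' y. True}
      \<union> {Poly_Mapping.single (x, y + y') 1 - Poly_Mapping.single (x, y) 1
           - Poly_Mapping.single (x, y') 1 | x y y'. True}
      \<union> {Poly_Mapping.single (c *\<^sub>C x, y) 1 - c *\<^sub>C Poly_Mapping.single (x, y) 1 | c x y. True}
      \<union> {Poly_Mapping.single (x, c *\<^sub>C y) 1 - c *\<^sub>C Poly_Mapping.single (x, y) 1 | c x y. True})"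
    for p :: "'a \<times> 'b \<Rightarrow>\<^sub>0 complex"
    unfolding tensor_null_def using that by (rule complex_vector.span_base)
  have "(x + x') \<otimes> y = x \<otimes> y + x' \<otimes> y" for x x' :: 'a and y :: 'b
    by transfer (unfold tensor_rel_def diff_diff_eq[symmetric], rule gen, blast)
  moreover have "x \<otimes> (y + y') = x \<otimes> y + x \<otimes> y'" for x :: 'a and y y' :: 'b
    by transfer (unfold tensor_rel_def diff_diff_eq[symmetric], rule gen, blast)
  moreover have "(c *\<^sub>C x) \<otimes> y = c *\<^sub>C (x \<otimes> y)" for c and x :: 'a and y :: 'b
    by transfer (unfold tensor_rel_def, rule gen, blast)
  moreover have "x \<otimes> (c *\<^sub>C y) = c *\<^sub>C (x \<otimes> y)" for c and x :: 'a and y :: 'b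
    by transfer (unfold tensor_rel_def, rule gen, blast)
  ultimately show ?thesis
    unfolding cbilinear_def by (simp add: clinearI)
qed

lemma ex1_tensor_lift:
  fixes f :: "'a::complex_vector \<Rightarrow> 'b::complex_vector \<Rightarrow> 'c::complex_vector"
  assumes "cbilinear f"
  shows "\<exists>!h. clinear h \<and> (\<forall>x y. h (x \<otimes> y) = f x y)"
proof -
  define F :: "('a \<times> 'b \<Rightarrow>\<^sub>0 complex) \<Rightarrow> 'c" where
    "F p = (\<Sum>k\<in>Poly_Mapping.keys p. Poly_Mapping.lookup p k *\<^sub>C f (fst k) (snd k))" for p
  have F_super: "F p = (\<Sum>k\<in>S. Poly_Mapping.lookup p k *\<^sub>C f (fst k) (snd k))"
    if "finite S" "Poly_Mapping.keys p \<subseteq> S" for p S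
    unfolding F_def
    using that by (intro sum.mono_neutral_left) (auto simp: in_keys_iff)
  have F_linear: "clinear F"
  proof (rule clinearI)
    fix p q
    show "F (p + q) = F p + F q"
      using F_super[of "Poly_Mapping.keys p \<union> Poly_Mapping.keys q" p] F_super[of "Poly_Mapping.keys p \<union> Poly_Mapping.keys q" q]
        F_super[of "Poly_Mapping.keys p \<union> Poly_Mapping.keys q" "p + q"] keys_add[of p q]
      by (simp add: lookup_add scaleC_add_left sum.distrib)
  next
    fix c and p :: "'a \<times> 'b \<Rightarrow>\<^sub>0 complex"
    have "Poly_Mapping.keys (c *\<^sub>C p) \<subseteq> Poly_Mapping.keys p"
      by (auto simp: in_keys_iff scaleC_poly_mapping.rep_eq)
    then show "F (c *\<^sub>C p) = c *\<^sub>C F p"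
      using F_super[of "Poly_Mapping.keys p" "c *\<^sub>C p"]
      by (simp add: F_def scaleC_poly_mapping.rep_eq scaleC_complex_def scaleC_scaleC
          complex_vector.scale_sum_right)
  qed
  have F_single: "F (Poly_Mapping.single (x, y) 1) = f x y" for x y
    by (simp add: F_def scaleC_one)
  have f_left: "f (x + x') y = f x y + f x' y" "f (c *\<^sub>C x) y = c *\<^sub>C f x y"
    and f_right: "f x (y + y') = f x y + f x y'" "f x (c *\<^sub>C y) = c *\<^sub>C f x y" for c x x' y y'
    using assms unfolding cbilinear_def
    by (blast intro: clinear_add[of "\<lambda>x. f x y"] clinear_scale[of "\<lambda>x. f x y"]
        clinear_add[of "f x"] clinear_scale[of "f x"])+
  have F_null: "F p = 0" if "p \<in> tensor_null" for p
    using that unfolding tensor_null_def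
  proof (induction rule: complex_vector.span_induct_alt)
    case base
    then show ?case by (simp add: F_def)
  next
    case (step c p q)
    have "F p = 0"
      using step(1)
      by (auto simp: clinear_diff[OF F_linear] clinear_scale[OF F_linear] F_single f_left f_right)
    then show ?case
      using step by (simp add: clinear_add[OF F_linear] clinear_scale[OF F_linear])
  qed
  have F_rel: "F p = F q" if "tensor_rel p q" for p q
    using F_null[of "p - q"] that by (simp add: tensor_rel_def clinear_diff[OF F_linear])
  define h where "h t = F (rep_tensor t)" for t
  have h_abs: "h (abs_tensor p) = F p" for p
    unfolding h_def
    by (rule F_rel, rule Quotient3_rep_abs[OF Quotient3_tensor])
      (simp add: tensor_rel_def tensor_null_zero)
  have abs_cases: "\<exists>p. t = abs_tensor p" for t :: "'a \<otimes> 'b"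
    using Quotient3_abs_rep[OF Quotient3_tensor, symmetric] by blast
  have h: "clinear h"
  proof (rule clinearI)
    fix s t :: "'a \<otimes> 'b" and c
    obtain p q where "s = abs_tensor p" "t = abs_tensor q"
      using abs_cases by blast
    then show "h (s + t) = h s + h t" and "h (c *\<^sub>C s) = c *\<^sub>C h s"
      by (simp_all add: plus_tensor.abs_eq scaleC_tensor.abs_eq h_abs clinear_add[OF F_linear]
          clinear_scale[OF F_linear])
  qed
  have h_tensor: "h (x \<otimes> y) = f x y" for x y
    by (simp add: tensor.abs_eq h_abs F_single)
  have abs_linear: "clinear (abs_tensor :: _ \<Rightarrow> 'a \<otimes> 'b)"
    by (rule clinearI) (simp_all add: plus_tensor.abs_eq scaleC_tensor.abs_eq)
  have uniq: "g = h" if g: "clinear g" "\<forall>x y. g (x \<otimes> y) = f x y" for g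
  proof
    fix t :: "'a \<otimes> 'b"
    obtain p where t: "t = abs_tensor p"
      using abs_cases by blast
    have p: "p = (\<Sum>k\<in>Poly_Mapping.keys p. Poly_Mapping.lookup p k *\<^sub>C Poly_Mapping.single k 1)"
    proof (rule poly_mapping_eqI)
      fix k
      have "Poly_Mapping.lookup (\<Sum>k\<in>Poly_Mapping.keys p. Poly_Mapping.lookup p k *\<^sub>C Poly_Mapping.single k 1) k
          = (\<Sum>k'\<in>Poly_Mapping.keys p. if k' = k then Poly_Mapping.lookup p k' else 0)"
        unfolding lookup_sum
        by (rule sum.cong)
          (simp_all add: scaleC_poly_mapping.rep_eq scaleC_complex_def lookup_single when_def)
      then show "Poly_Mapping.lookup p k = Poly_Mapping.lookup (\<Sum>k\<in>Poly_Mapping.keys p. Poly_Mapping.lookup p k *\<^sub>C Poly_Mapping.single k 1) k"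
        by (simp add: sum.delta in_keys_iff)
    qed
    have "t = abs_tensor (\<Sum>k\<in>Poly_Mapping.keys p. Poly_Mapping.lookup p k *\<^sub>C Poly_Mapping.single k 1)"
      unfolding t by (rule arg_cong[OF p])
    then have t_sum: "t = (\<Sum>k\<in>Poly_Mapping.keys p. Poly_Mapping.lookup p k *\<^sub>C (fst k \<otimes> snd k))"
      by (simp only: clinear_sum[OF abs_linear] clinear_scale[OF abs_linear] tensor.abs_eq prod.collapse)
    show "g t = h t"
      unfolding t_sum clinear_sum[OF g(1)] clinear_sum[OF h] clinear_scale[OF g(1)] clinear_scale[OF h]
      using g(2) h_tensor by simp
  qed
  show ?thesis
    by (rule ex1I[of _ h]) (use h h_tensor uniq in blast)+
qed

definition tensor_map :: "('a::complex_vector \<Rightarrow> 'c::complex_vector) \<Rightarrow>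
    ('b::complex_vector \<Rightarrow> 'd::complex_vector) \<Rightarrow> 'a \<otimes> 'b \<Rightarrow> 'c \<otimes> 'd" where
  "tensor_map f g = tensor_lift (\<lambda>x y. f x \<otimes> g y)"

definition tensor_swap :: "'a::complex_vector \<otimes> 'b::complex_vector \<Rightarrow> 'b \<otimes> 'a" where
  "tensor_swap = tensor_lift (\<lambda>x y. y \<otimes> x)"

definition tensor_assoc ::
  "'a::complex_vector \<otimes> ('b::complex_vector \<otimes> 'c::complex_vector) \<Rightarrow> 'a \<otimes> 'b \<otimes> 'c" where
  "tensor_assoc = tensor_lift (\<lambda>x. tensor_lift (\<lambda>y z. x \<otimes> y \<otimes> z))"

definition tau12 :: "'a::complex_vector \<otimes> 'b::complex_vector \<otimes> 'c::complex_vector \<Rightarrow> 'b \<otimes> 'a \<otimes> 'c" where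
  "tau12 = tensor_map tensor_swap id"

text \<open>For a family \<open>F\<^sub>\<lambda>\<close> polynomial in \<open>\<lambda>\<close>: the families \<open>F\<^sub>\<lambda> \<otimes> g\<close> and \<open>g \<otimes> F\<^sub>\<lambda>\<close>.\<close>

definition poly_tensor :: "('a::complex_vector \<Rightarrow> 'c::complex_vector poly) \<Rightarrow>
    ('b::complex_vector \<Rightarrow> 'd::complex_vector) \<Rightarrow> 'a \<otimes> 'b \<Rightarrow> ('c \<otimes> 'd) poly" where
  "poly_tensor F g = tensor_lift (\<lambda>x y. map_poly (\<lambda>z. z \<otimes> g y) (F x))"

definition tensor_poly :: "('a::complex_vector \<Rightarrow> 'c::complex_vector) \<Rightarrow>
    ('b::complex_vector \<Rightarrow> 'd::complex_vector poly) \<Rightarrow> 'a \<otimes> 'b \<Rightarrow> ('c \<otimes> 'd) poly" where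
  "tensor_poly g F = tensor_lift (\<lambda>x y. map_poly (\<lambda>z. g x \<otimes> z) (F y))"


section \<open>Substitution of operators for the formal variable\<close>

definition subst_op :: "('a::complex_vector \<Rightarrow> 'a) \<Rightarrow> 'a poly \<Rightarrow> 'a" where
  "subst_op T p = (\<Sum>n\<le>degree p. (T ^^ n) (coeff p n))"

text \<open>\<open>'a poly poly\<close> is \<open>'a[\<lambda>,\<mu>]\<close> with \<open>\<lambda>\<close> the outer and \<open>\<mu>\<close> the inner variable; the following are
  the multiplication operators by the variables and the embedding of constants.\<close>

definition lam :: "'a::complex_vector poly poly \<Rightarrow> 'a poly poly" where
  "lam p = pCons 0 p"

definition mu :: "'a::complex_vector poly poly \<Rightarrow> 'a poly poly" where
  "mu p = map_poly (pCons 0) p"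

definition const2 :: "'a::complex_vector \<Rightarrow> 'a poly poly" where
  "const2 x = [:[:x:]:]"


section \<open>Hom-left-symmetric conformal algebras\<close>

text \<open>\<open>D\<close> is the action of \<open>\<partial>\<close> (a \<open>\<complex>[\<partial>]\<close>-module is a complex vector space with an endomorphism),
  and \<open>lp a b\<close> is the \<open>\<lambda>\<close>-product \<open>a\<^sub>\<lambda> b\<close>, a polynomial in \<open>\<lambda>\<close>.\<close>

text \<open>\<open>x\<^sub>T y\<close> in \<open>'a[\<lambda>,\<mu>]\<close>, for \<open>T\<close> multiplication by an element of \<open>\<complex>[\<lambda>,\<mu>]\<close>.\<close>

definition prod_at :: "('a::complex_vector \<Rightarrow> 'a \<Rightarrow> 'a poly) \<Rightarrow>
    ('a poly poly \<Rightarrow> 'a poly poly) \<Rightarrow> 'a \<Rightarrow> 'a \<Rightarrow> 'a poly poly" where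
  "prod_at lp T x y = subst_op T (map_poly const2 (lp x y))"

text \<open>\<open>(a\<^sub>S b)\<^bsub>\<lambda>+\<mu>\<^esub> c\<close> and \<open>a\<^sub>S (b\<^sub>T c)\<close>, expanding the inner product in powers of its variable.\<close>

definition prod_left :: "('a::complex_vector \<Rightarrow> 'a \<Rightarrow> 'a poly) \<Rightarrow>
    ('a poly poly \<Rightarrow> 'a poly poly) \<Rightarrow> 'a \<Rightarrow> 'a \<Rightarrow> 'a \<Rightarrow> 'a poly poly" where
  "prod_left lp S a b c =
     subst_op S (map_poly (\<lambda>z. prod_at lp (\<lambda>q. lam q + mu q) z c) (lp a b))"

definition prod_right :: "('a::complex_vector \<Rightarrow> 'a \<Rightarrow> 'a poly) \<Rightarrow>
    ('a poly poly \<Rightarrow> 'a poly poly) \<Rightarrow> ('a poly poly \<Rightarrow> 'a poly poly) \<Rightarrow>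
    'a \<Rightarrow> 'a \<Rightarrow> 'a \<Rightarrow> 'a poly poly" where
  "prod_right lp S T a b c = subst_op T (map_poly (\<lambda>z. prod_at lp S a z) (lp b c))"

locale hom_left_symmetric_conformal_algebra =
  fixes D \<alpha> :: "'a::complex_vector \<Rightarrow> 'a" and lp :: "'a \<Rightarrow> 'a \<Rightarrow> 'a poly"
  assumes linear_D: "clinear D"
    and linear_alpha: "clinear \<alpha>"
    and alpha_D: "\<alpha> (D x) = D (\<alpha> x)"
    and bilinear_lp: "cbilinear lp"
    and lp_D_left: "lp (D a) b = - pCons 0 (lp a b)"
    and lp_D_right: "lp a (D b) = map_poly D (lp a b) + pCons 0 (lp a b)"
    and alpha_lp: "map_poly \<alpha> (lp a b) = lp (\<alpha> a) (\<alpha> b)"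
    and left_symmetric:
      "prod_left lp lam a b (\<alpha> c) - prod_right lp lam mu (\<alpha> a) b c
        = prod_left lp mu b a (\<alpha> c) - prod_right lp mu lam (\<alpha> b) a c"

text \<open>The commutator \<open>[a\<^sub>\<lambda> b] = a\<^sub>\<lambda> b - b\<^bsub>-\<lambda>-\<partial>\<^esub> a\<close>, where \<open>-\<lambda>-\<partial>\<close> operates on \<open>'a[\<lambda>]\<close>.\<close>

definition bracket :: "('a::complex_vector \<Rightarrow> 'a) \<Rightarrow> ('a \<Rightarrow> 'a \<Rightarrow> 'a poly) \<Rightarrow> 'a \<Rightarrow> 'a \<Rightarrow> 'a poly" where
  "bracket D lp a b =
     lp a b - subst_op (\<lambda>q. - pCons 0 q - map_poly D q) (map_poly (\<lambda>z. [:z:]) (lp b a))"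

definition D_tensor2 :: "('a::complex_vector \<Rightarrow> 'a) \<Rightarrow> 'a \<otimes> 'a \<Rightarrow> 'a \<otimes> 'a" where
  "D_tensor2 D t = tensor_map D id t + tensor_map id D t"

definition D_1 :: "('a::complex_vector \<Rightarrow> 'a) \<Rightarrow> 'a \<otimes> 'a \<otimes> 'a \<Rightarrow> 'a \<otimes> 'a \<otimes> 'a" where
  "D_1 D = tensor_map (tensor_map D id) id"

definition D_2 :: "('a::complex_vector \<Rightarrow> 'a) \<Rightarrow> 'a \<otimes> 'a \<otimes> 'a \<Rightarrow> 'a \<otimes> 'a \<otimes> 'a" where
  "D_2 D = tensor_map (tensor_map id D) id"

definition D_3 :: "('a::complex_vector \<Rightarrow> 'a) \<Rightarrow> 'a \<otimes> 'a \<otimes> 'a \<Rightarrow> 'a \<otimes> 'a \<otimes> 'a" where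
  "D_3 D = tensor_map (tensor_map id id) D"

definition D_tensor3 :: "('a::complex_vector \<Rightarrow> 'a) \<Rightarrow> 'a \<otimes> 'a \<otimes> 'a \<Rightarrow> 'a \<otimes> 'a \<otimes> 'a" where
  "D_tensor3 D t = D_1 D t + D_2 D t + D_3 D t"


section \<open>Hom-left-symmetric conformal coalgebras\<close>

locale hom_left_symmetric_conformal_coalgebra =
  fixes D :: "'a::complex_vector \<Rightarrow> 'a" and \<Delta> :: "'a \<Rightarrow> 'a \<otimes> 'a" and \<alpha> :: "'a \<Rightarrow> 'a"
  assumes linear_D: "clinear D"
    and linear_alpha: "clinear \<alpha>"
    and alpha_D: "\<alpha> (D x) = D (\<alpha> x)"
    and linear_Delta: "clinear \<Delta>"
    and Delta_D: "\<Delta> (D x) = D_tensor2 D (\<Delta> x)"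
    and coassociator_symmetric:
      "tensor_assoc (tensor_map \<alpha> \<Delta> (\<Delta> x)) - tau12 (tensor_assoc (tensor_map \<alpha> \<Delta> (\<Delta> x)))
        = tensor_map \<Delta> \<alpha> (\<Delta> x) - tau12 (tensor_map \<Delta> \<alpha> (\<Delta> x))"


section \<open>The coboundary operator and its obstruction\<close>

definition coboundary :: "('a::complex_vector \<Rightarrow> 'a) \<Rightarrow> ('a \<Rightarrow> 'a) \<Rightarrow> ('a \<Rightarrow> 'a \<Rightarrow> 'a poly) \<Rightarrow>
    'a \<otimes> 'a \<Rightarrow> 'a \<Rightarrow> 'a \<otimes> 'a" where
  "coboundary D \<alpha> lp r a =
     subst_op (\<lambda>t. - D_tensor2 D t)
       (poly_tensor (lp a) \<alpha> r + tensor_poly \<alpha> (bracket D lp a) r)"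

definition P_op :: "('a::complex_vector \<Rightarrow> 'a) \<Rightarrow> ('a \<Rightarrow> 'a \<Rightarrow> 'a poly) \<Rightarrow>
    'a \<Rightarrow> 'a \<otimes> 'a \<Rightarrow> ('a \<otimes> 'a) poly" where
  "P_op \<alpha> lp x t = poly_tensor (lp x) \<alpha> t + tensor_poly \<alpha> (lp x) t"

definition Q_op :: "('a::complex_vector \<Rightarrow> 'a) \<Rightarrow> ('a \<Rightarrow> 'a) \<Rightarrow> ('a \<Rightarrow> 'a \<Rightarrow> 'a poly) \<Rightarrow>
    'a \<Rightarrow> 'a \<otimes> 'a \<otimes> 'a \<Rightarrow> ('a \<otimes> 'a \<otimes> 'a) poly" where
  "Q_op D \<alpha> lp x t =
     poly_tensor (poly_tensor (lp x) \<alpha>) \<alpha> t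
     + poly_tensor (tensor_poly \<alpha> (lp x)) \<alpha> t
     + tensor_poly (tensor_map \<alpha> \<alpha>) (bracket D lp x) t"

text \<open>\<open>[[r,r]]\<close>, \<open>M(a)\<close> and \<open>J\<^sub>\<delta>(a)\<close> for \<open>r = (\<Sum>i\<in>I. u i \<otimes> v i)\<close>.\<close>

definition rr_bracket :: "('a::complex_vector \<Rightarrow> 'a) \<Rightarrow> ('a \<Rightarrow> 'a) \<Rightarrow> ('a \<Rightarrow> 'a \<Rightarrow> 'a poly) \<Rightarrow>
    'i set \<Rightarrow> ('i \<Rightarrow> 'a) \<Rightarrow> ('i \<Rightarrow> 'a) \<Rightarrow> 'a \<otimes> 'a \<otimes> 'a" where
  "rr_bracket D \<alpha> lp I u v =
     (\<Sum>i\<in>I. \<Sum>j\<in>I. subst_op (D_3 D) (map_poly (\<lambda>z. z \<otimes> \<alpha> (v j) \<otimes> \<alpha> (v i)) (lp (u i) (u j))))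
     - (\<Sum>i\<in>I. \<Sum>j\<in>I. subst_op (D_3 D) (map_poly (\<lambda>z. \<alpha> (v j) \<otimes> z \<otimes> \<alpha> (v i)) (lp (u i) (u j))))
     - (\<Sum>i\<in>I. \<Sum>j\<in>I. subst_op (D_1 D)
          (map_poly (\<lambda>z. \<alpha> (u j) \<otimes> z \<otimes> \<alpha> (v i)) (bracket D lp (v j) (u i))))
     + (\<Sum>i\<in>I. \<Sum>j\<in>I. subst_op (D_2 D)
          (map_poly (\<lambda>z. z \<otimes> \<alpha> (u j) \<otimes> \<alpha> (v i)) (bracket D lp (v j) (u i))))
     - (\<Sum>i\<in>I. \<Sum>j\<in>I. subst_op (D_1 D)
          (map_poly (\<lambda>z. \<alpha> (u i) \<otimes> \<alpha> (u j) \<otimes> z) (bracket D lp (v i) (v j))))"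

text \<open>In each summand of \<open>M(a)\<close> the outer \<open>subst_op\<close> is for the variable of the innermost
  product, in whose powers the expression is expanded first.\<close>

definition M_term :: "('a::complex_vector \<Rightarrow> 'a) \<Rightarrow> ('a \<Rightarrow> 'a) \<Rightarrow> ('a \<Rightarrow> 'a \<Rightarrow> 'a poly) \<Rightarrow>
    'i set \<Rightarrow> ('i \<Rightarrow> 'a) \<Rightarrow> ('i \<Rightarrow> 'a) \<Rightarrow> 'a \<Rightarrow> 'a \<otimes> 'a \<otimes> 'a" where
  "M_term D \<alpha> lp I u v a =
     (let s = (\<Sum>i\<in>I. u i \<otimes> v i) - (\<Sum>i\<in>I. v i \<otimes> u i) in
      (\<Sum>j\<in>I. subst_op (\<lambda>t. - D_tensor3 D t)
         (map_poly
            (\<lambda>z. subst_op (\<lambda>t. - tensor_map (D_tensor2 D) id t)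
                   (map_poly (\<lambda>w. w \<otimes> \<alpha> (\<alpha> (v j))) (P_op \<alpha> lp z s)))
            (lp a (u j))))
      - (\<Sum>j\<in>I. subst_op (D_3 D)
         (map_poly
            (\<lambda>w. subst_op (\<lambda>t. - D_tensor3 D t)
                   (map_poly (\<lambda>w'. w' \<otimes> \<alpha> (\<alpha> (v j))) (P_op \<alpha> lp (\<alpha> a) w)))
            (P_op \<alpha> lp (u j) s))))"

definition J_obstruction :: "('a::complex_vector \<Rightarrow> 'a) \<Rightarrow> ('a \<Rightarrow> 'a) \<Rightarrow> ('a \<Rightarrow> 'a \<Rightarrow> 'a poly) \<Rightarrow>
    'i set \<Rightarrow> ('i \<Rightarrow> 'a) \<Rightarrow> ('i \<Rightarrow> 'a) \<Rightarrow> 'a \<Rightarrow> 'a \<otimes> 'a \<otimes> 'a" where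
  "J_obstruction D \<alpha> lp I u v a =
     tensor_map (tensor_map \<alpha> \<alpha>) \<alpha>
       (subst_op (\<lambda>t. - D_tensor3 D t) (Q_op D \<alpha> lp a (rr_bracket D \<alpha> lp I u v)))
     + M_term D \<alpha> lp I u v a"

end

theory Submission
  imports Defs
begin

text \<open>Let \<open>X(a) = (\<alpha> \<otimes> \<delta>)\<delta>(a) - (\<delta> \<otimes> \<alpha>)\<delta>(a)\<close>. The obstruction is \<open>J\<^sub>\<delta>(a) = -(X(a) - \<tau>\<^sub>1\<^sub>2 X(a))\<close>, as a
  term-by-term comparison shows. All variables in both expressions are governed by momentum conservation:
  \<open>a\<close> carries \<open>\<partial>\<^sup>\<otimes>\<^sup>3\<close>, the two factors of \<open>r\<close> carry opposite momenta, and each product conserves momentum,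
  so that every term of the ordinary Hom-left-symmetric computation has a unique conformal counterpart.
  Invariance of \<open>r\<close> under \<open>\<alpha> \<otimes> \<alpha>\<close> matches the powers of \<open>\<alpha>\<close>. Left symmetry is used once, for
  \<open>[a,l] r\<close> in the second factor, and through the Hom-Jacobi identity for \<open>[a,[l,l']]\<close> in the third.\<close>

section \<open>Linear maps and tensor products\<close>

text \<open>As formal expressions, nested substitutions such as those in M depend on an order of
  expansion. Here each variable is evaluated at an operator on A \<otimes> A \<otimes> A as early as
  possible. All operators that occur are integral combinations of \<partial> on the three slots, so
  they commute and the formal axioms become identities between values. Among left factor, right
  factor and value of a product, two operators determine the third; this fixes the variable of the
  swapped half of a bracket. The products r r' of first factors, and the halves r l' of the brackets
  [l', r] in [[r,r]], produce terms that do not occur in the coassociator; M supplies them with the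
  opposite sign. M depends linearly on \<open>r_12 - r_21\<close>, and this difference is what makes
  its terms come in antisymmetrised pairs.\<close>

lemma clinear_0: "clinear h \<Longrightarrow> h 0 = 0"
  using clinear_scale[of h 0 0] by simp

lemma clinear_minus: "clinear h \<Longrightarrow> h (- x) = - h x"
  using clinear_diff[of h 0 x] clinear_0[of h] by simp

lemma clinear_ident: "clinear (\<lambda>x. x)"
  by (rule clinearI) simp_all

lemma clinear_compose: "clinear g \<Longrightarrow> clinear f \<Longrightarrow> clinear (\<lambda>x. g (f x))"
  by (rule clinearI) (simp_all add: clinear_add clinear_scale)

lemma clinear_plus: "clinear f \<Longrightarrow> clinear g \<Longrightarrow> clinear (\<lambda>x. f x + g x)"
  by (rule clinearI) (simp_all add: clinear_add clinear_scale scaleC_add_right)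

lemma clinear_uminus: "clinear f \<Longrightarrow> clinear (\<lambda>x. - f x)"
  by (rule clinearI) (simp_all add: clinear_add clinear_scale)

lemma clinear_minus_fun: "clinear f \<Longrightarrow> clinear g \<Longrightarrow> clinear (\<lambda>x. f x - g x)"
  using clinear_plus[OF _ clinear_uminus, of f g] by simp

lemma clinear_sum_fun: "(\<And>i. i \<in> S \<Longrightarrow> clinear (f i)) \<Longrightarrow> clinear (\<lambda>x. \<Sum>i\<in>S. f i x)"
  by (rule clinearI) (simp_all add: clinear_add clinear_scale sum.distrib complex_vector.scale_sum_right)

lemma clinear_funpow:
  fixes T :: "'a::complex_vector \<Rightarrow> 'a"
  assumes T: "clinear T"
  shows "clinear (T ^^ n)"
proof (rule clinearI)
  show "(T ^^ n) (x + y) = (T ^^ n) x + (T ^^ n) y" for x y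
    by (induction n) (simp_all add: clinear_add[OF T])
  show "(T ^^ n) (c *\<^sub>C x) = c *\<^sub>C (T ^^ n) x" for c x
    by (induction n) (simp_all add: clinear_scale[OF T])
qed

lemma clinear_map_poly: "clinear f \<Longrightarrow> clinear (map_poly f)"
  by (rule clinearI)
    (simp_all add: poly_eq_iff coeff_map_poly clinear_0 clinear_add clinear_scale scaleC_poly_def)

lemma clinear_pCons_0: "clinear (pCons 0)"
  by (rule clinearI) (simp_all add: poly_eq_iff coeff_pCons coeff_map_poly scaleC_poly_def split: nat.split)

lemma clinear_pCons_const: "clinear (\<lambda>z. [:z:])"
  by (rule clinearI) (simp_all add: poly_eq_iff coeff_pCons coeff_map_poly scaleC_poly_def split: nat.split)

lemma cbilinearI:
  "(\<And>y. clinear (\<lambda>x. f x y)) \<Longrightarrow> (\<And>x. clinear (f x)) \<Longrightarrow> cbilinear f"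
  by (simp add: cbilinear_def)

lemma cbilinear_left: "cbilinear f \<Longrightarrow> clinear g \<Longrightarrow> clinear (\<lambda>x. f (g x) y)"
  unfolding cbilinear_def using clinear_compose[of "\<lambda>x. f x y" g] by blast

lemma cbilinear_right: "cbilinear f \<Longrightarrow> clinear g \<Longrightarrow> clinear (\<lambda>x. f y (g x))"
  unfolding cbilinear_def using clinear_compose[of "f y" g] by blast

lemmas clinear_tensor_left = cbilinear_left[OF cbilinear_tensor]
  and clinear_tensor_right = cbilinear_right[OF cbilinear_tensor]

lemmas tensor_add_left = clinear_add[OF clinear_tensor_left[OF clinear_ident]]
  and tensor_add_right = clinear_add[OF clinear_tensor_right[OF clinear_ident]]

lemmas tensor_0_left = clinear_0[OF clinear_tensor_left[OF clinear_ident]]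
  and tensor_0_right = clinear_0[OF clinear_tensor_right[OF clinear_ident]]

lemma tensor_lift_linear: "cbilinear f \<Longrightarrow> clinear (tensor_lift f)"
  and tensor_lift_tensor: "cbilinear f \<Longrightarrow> tensor_lift f (x \<otimes> y) = f x y"
  using theI'[OF ex1_tensor_lift, of f] by (auto simp: tensor_lift_def)

text \<open>Both maps lift the same bilinear map, so the uniqueness half of the universal property
  identifies them.\<close>

lemma tensor_eqI:
  fixes g h :: "'a::complex_vector \<otimes> 'b::complex_vector \<Rightarrow> 'c::complex_vector"
  assumes "clinear g" "clinear h" and eq: "\<And>x y. g (x \<otimes> y) = h (x \<otimes> y)"
  shows "g t = h t"
proof -
  have "cbilinear (\<lambda>x y. h (x \<otimes> y))"
    by (intro cbilinearI clinear_compose[OF assms(2)] clinear_tensor_left clinear_tensor_right clinear_ident)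
  from ex1_tensor_lift[OF this] have "g = h"
    using assms by auto
  then show ?thesis by simp
qed

lemma tensor3_eqI:
  fixes g h :: "'a::complex_vector \<otimes> 'b::complex_vector \<otimes> 'd::complex_vector \<Rightarrow> 'c::complex_vector"
  assumes "clinear g" "clinear h" and eq: "\<And>x y z. g (x \<otimes> y \<otimes> z) = h (x \<otimes> y \<otimes> z)"
  shows "g t = h t"
proof (rule tensor_eqI[OF assms(1,2)])
  fix s z
  show "g (s \<otimes> z) = h (s \<otimes> z)"
    by (rule tensor_eqI[where t = s])
      (intro clinear_compose[OF assms(1)] clinear_compose[OF assms(2)] clinear_tensor_left clinear_ident eq)+
qed

lemma tensor_map_bilinear: "clinear f \<Longrightarrow> clinear g \<Longrightarrow> cbilinear (\<lambda>x y. f x \<otimes> g y)"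
  by (intro cbilinearI clinear_tensor_left clinear_tensor_right)

lemma tensor_map_linear: "clinear f \<Longrightarrow> clinear g \<Longrightarrow> clinear (tensor_map f g)"
  unfolding tensor_map_def by (intro tensor_lift_linear tensor_map_bilinear)

lemma tensor_map_tensor: "clinear f \<Longrightarrow> clinear g \<Longrightarrow> tensor_map f g (x \<otimes> y) = f x \<otimes> g y"
  unfolding tensor_map_def by (intro tensor_lift_tensor tensor_map_bilinear)

lemma tensor_swap_bilinear: "cbilinear (\<lambda>x y. y \<otimes> x)"
  by (intro cbilinearI clinear_tensor_left clinear_tensor_right clinear_ident)

lemma tensor_swap_linear: "clinear tensor_swap"
  unfolding tensor_swap_def by (intro tensor_lift_linear tensor_swap_bilinear)

lemma tensor_swap_tensor: "tensor_swap (x \<otimes> y) = y \<otimes> x"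
  unfolding tensor_swap_def by (intro tensor_lift_tensor tensor_swap_bilinear)

lemma clinear_id: "clinear id"
  unfolding id_def by (rule clinear_ident)

lemma tau12_linear: "clinear tau12"
  unfolding tau12_def by (intro tensor_map_linear tensor_swap_linear clinear_id)

lemma tau12_tensor: "tau12 (x \<otimes> y \<otimes> z) = y \<otimes> x \<otimes> z"
  by (simp add: tau12_def tensor_map_tensor tensor_swap_linear clinear_id tensor_swap_tensor)

text \<open>For lifts of bilinear maps that carry a parameter: the inner lift in
  \<open>tensor_assoc\<close>, and the acting element in \<open>P_op\<close>.\<close>

lemma tensor_lift_linear_param:
  assumes "\<And>x. cbilinear (f x)" "\<And>y z. clinear (\<lambda>x. f x y z)"
  shows "clinear (\<lambda>x. tensor_lift (f x) t)"
proof (rule clinearI)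
  fix x x' c
  note lift = tensor_lift_linear[OF assms(1)] and lift_tensor = tensor_lift_tensor[OF assms(1)]
  show "tensor_lift (f (x + x')) t = tensor_lift (f x) t + tensor_lift (f x') t"
    by (rule tensor_eqI[OF lift clinear_plus[OF lift lift]])
      (simp only: lift_tensor clinear_add[OF assms(2)])
  have "clinear (\<lambda>t. c *\<^sub>C tensor_lift (f x) t)"
    by (rule clinearI)
      (simp_all add: clinear_add[OF lift] clinear_scale[OF lift] scaleC_add_right scaleC_scaleC mult.commute)
  then show "tensor_lift (f (c *\<^sub>C x)) t = c *\<^sub>C tensor_lift (f x) t"
    by (rule tensor_eqI[OF lift]) (simp only: lift_tensor clinear_scale[OF assms(2)])
qed

lemma tensor_assoc_bilinear: "cbilinear (\<lambda>y z. x \<otimes> y \<otimes> z)"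
  by (intro cbilinearI clinear_tensor_left clinear_tensor_right clinear_ident)

lemma tensor_assoc_outer_bilinear: "cbilinear (\<lambda>x. tensor_lift (\<lambda>y z. x \<otimes> y \<otimes> z))"
  by (intro cbilinearI tensor_lift_linear tensor_lift_linear_param tensor_assoc_bilinear
      clinear_tensor_left clinear_ident)

lemma tensor_assoc_linear: "clinear tensor_assoc"
  unfolding tensor_assoc_def by (intro tensor_lift_linear tensor_assoc_outer_bilinear)

lemma tensor_assoc_tensor: "tensor_assoc (x \<otimes> (y \<otimes> z)) = x \<otimes> y \<otimes> z"
  by (simp add: tensor_assoc_def tensor_lift_tensor tensor_assoc_outer_bilinear tensor_assoc_bilinear)

lemma poly_tensor_bilinear:
  assumes "clinear F" "clinear g"
  shows "cbilinear (\<lambda>x y. map_poly (\<lambda>z. z \<otimes> g y) (F x))"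
proof (rule cbilinearI)
  show "clinear (\<lambda>x. map_poly (\<lambda>z. z \<otimes> g y) (F x))" for y
    by (intro clinear_compose[OF _ assms(1)] clinear_map_poly clinear_tensor_left clinear_ident)
  have coeff: "coeff (map_poly (\<lambda>z. z \<otimes> g y) p) n = coeff p n \<otimes> g y" for y p n
    by (simp add: coeff_map_poly tensor_0_left tensor_0_right)
  show "clinear (\<lambda>y. map_poly (\<lambda>z. z \<otimes> g y) (F x))" for x
    by (rule clinearI; simp only: poly_eq_iff coeff coeff_add scaleC_poly_def
        coeff_map_poly complex_vector.scale_zero_right)
      (simp_all only: simp_thms clinear_add[OF clinear_tensor_right[OF assms(2)]]
        clinear_scale[OF clinear_tensor_right[OF assms(2)]])
qed

lemma poly_tensor_linear: "clinear F \<Longrightarrow> clinear g \<Longrightarrow> clinear (poly_tensor F g)"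
  unfolding poly_tensor_def by (intro tensor_lift_linear poly_tensor_bilinear)

lemma poly_tensor_tensor:
  "clinear F \<Longrightarrow> clinear g \<Longrightarrow> poly_tensor F g (x \<otimes> y) = map_poly (\<lambda>z. z \<otimes> g y) (F x)"
  unfolding poly_tensor_def by (intro tensor_lift_tensor poly_tensor_bilinear)

lemma tensor_poly_bilinear:
  assumes "clinear F" "clinear g"
  shows "cbilinear (\<lambda>x y. map_poly (\<lambda>z. g x \<otimes> z) (F y))"
proof (rule cbilinearI)
  show "clinear (\<lambda>y. map_poly (\<lambda>z. g x \<otimes> z) (F y))" for x
    by (intro clinear_compose[OF _ assms(1)] clinear_map_poly clinear_tensor_right clinear_ident)
  have coeff: "coeff (map_poly (\<lambda>z. g x \<otimes> z) p) n = g x \<otimes> coeff p n" for x p n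
    by (simp add: coeff_map_poly tensor_0_left tensor_0_right)
  show "clinear (\<lambda>x. map_poly (\<lambda>z. g x \<otimes> z) (F y))" for y
    by (rule clinearI; simp only: poly_eq_iff coeff coeff_add scaleC_poly_def
        coeff_map_poly complex_vector.scale_zero_right)
      (simp_all only: simp_thms clinear_add[OF clinear_tensor_left[OF assms(2)]]
        clinear_scale[OF clinear_tensor_left[OF assms(2)]])
qed

lemma tensor_poly_linear: "clinear F \<Longrightarrow> clinear g \<Longrightarrow> clinear (tensor_poly g F)"
  unfolding tensor_poly_def by (intro tensor_lift_linear tensor_poly_bilinear)

lemma tensor_poly_tensor:
  "clinear F \<Longrightarrow> clinear g \<Longrightarrow> tensor_poly g F (x \<otimes> y) = map_poly (\<lambda>z. g x \<otimes> z) (F y)"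
  unfolding tensor_poly_def by (intro tensor_lift_tensor tensor_poly_bilinear)

section \<open>Substituting operators into vector-valued polynomials\<close>

text \<open>The degree can drop under addition, scaling and \<open>map_poly\<close>, so sums are
  compared up to a common bound instead of the degree used in \<open>subst_op\<close>.\<close>

lemma subst_op_bound:
  assumes "clinear T" "degree p \<le> N"
  shows "subst_op T p = (\<Sum>n\<le>N. (T ^^ n) (coeff p n))"
  unfolding subst_op_def
  by (rule sum.mono_neutral_left)
    (use assms in \<open>auto simp: coeff_eq_0 clinear_0[OF clinear_funpow]\<close>)

lemma subst_op_linear:
  assumes "clinear T"
  shows "clinear (subst_op T)"
proof (rule clinearI)
  fix p q :: "'a poly" and c
  show "subst_op T (p + q) = subst_op T p + subst_op T q"
    using subst_op_bound[OF assms, of _ "max (degree p) (degree q)"]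
    by (simp add: degree_add_le sum.distrib clinear_add[OF clinear_funpow[OF assms]])
  have "degree (c *\<^sub>C p) \<le> degree p"
    unfolding scaleC_poly_def by (rule map_poly_degree_leq)
  then show "subst_op T (c *\<^sub>C p) = c *\<^sub>C subst_op T p"
    using subst_op_bound[OF assms, of _ "degree p"]
    by (simp add: scaleC_poly_def coeff_map_poly clinear_scale[OF clinear_funpow[OF assms]]
        complex_vector.scale_sum_right)
qed

text \<open>Evaluation of \<open>p\<close> at \<lambda> = \<open>T\<close>, after \<open>f\<close>
  has carried the coefficients into the module on which \<open>T\<close> acts. Keeping
  \<open>f\<close> separate lets \<open>T\<close> act on slots other than the one that holds the
  product.\<close>

definition subst_map ::
  "('b::complex_vector \<Rightarrow> 'b) \<Rightarrow> ('a::complex_vector \<Rightarrow> 'b) \<Rightarrow> 'a poly \<Rightarrow> 'b" where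
  "subst_map T f p = subst_op T (map_poly f p)"

lemma subst_map_bound:
  assumes "clinear T" "clinear f" "degree p \<le> N"
  shows "subst_map T f p = (\<Sum>n\<le>N. (T ^^ n) (f (coeff p n)))"
  unfolding subst_map_def
  by (subst subst_op_bound[OF assms(1), of _ N])
    (use assms map_poly_degree_leq[of f p] in \<open>auto simp: coeff_map_poly clinear_0\<close>)

lemma subst_map_linear: "clinear T \<Longrightarrow> clinear f \<Longrightarrow> clinear (subst_map T f)"
  unfolding subst_map_def by (intro clinear_compose[OF subst_op_linear] clinear_map_poly)

lemma subst_map_compose: "clinear T \<Longrightarrow> clinear f \<Longrightarrow> clinear g \<Longrightarrow>
    subst_map T f (map_poly g p) = subst_map T (\<lambda>x. f (g x)) p"
  by (simp add: subst_map_def map_poly_map_poly clinear_0 comp_def)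

lemma subst_map_pCons_0:
  assumes "clinear T" "clinear f"
  shows "subst_map T f (pCons 0 p) = T (subst_map T f p)"
proof -
  have "subst_map T f (pCons 0 p) = (\<Sum>n\<le>Suc (degree p). (T ^^ n) (f (coeff (pCons 0 p) n)))"
    using assms degree_pCons_le[of 0 p] by (intro subst_map_bound)
  also have "\<dots> = T (subst_map T f p)"
    unfolding sum.atMost_Suc_shift
    by (simp add: subst_map_bound[OF assms order_refl] clinear_0[OF assms(2)]
        clinear_sum[OF assms(1)])
  finally show ?thesis .
qed

lemma subst_map_const: "clinear T \<Longrightarrow> clinear f \<Longrightarrow> subst_map T f [:x:] = f x"
  by (subst subst_map_bound[of _ _ _ 0]) auto

text \<open>Holds power by power. Most changes of variable below are instances, with
  \<open>h\<close> an action of a, a coproduct, \<tau>12, or the evaluation of an outer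
  product.\<close>

lemma subst_map_intertwine:
  assumes "clinear T" "clinear T'" "clinear f" "clinear h" and "\<And>t. h (T t) = T' (h t)"
  shows "h (subst_map T f p) = subst_map T' (\<lambda>x. h (f x)) p"
proof -
  have "h ((T ^^ n) t) = (T' ^^ n) (h t)" for n t
    by (induction n) (auto simp: assms(5))
  then show ?thesis
    using assms by (simp add: subst_map_bound[OF _ _ order_refl] clinear_compose clinear_sum)
qed

text \<open>Both sides are the same double sum once powers of commuting operators are exchanged. The
  order of two substitutions is thus irrelevant when neither product is a factor of the
  other.\<close>

lemma subst_map_swap:
  assumes "clinear S" "clinear T" "\<And>t. S (T t) = T (S t)" "cbilinear f"
  shows "subst_map S (\<lambda>x. subst_map T (\<lambda>y. f x y) q) p = subst_map T (\<lambda>y. subst_map S (\<lambda>x. f x y) p) q"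
proof -
  note lin = assms(4)[unfolded cbilinear_def, THEN conjunct1, rule_format]
    assms(4)[unfolded cbilinear_def, THEN conjunct2, rule_format]
  have 1: "clinear (\<lambda>x. subst_map T (\<lambda>y. f x y) q)"
    using assms(2) by (auto simp: subst_map_bound[OF _ _ order_refl] lin
        intro!: clinear_sum_fun clinear_compose[OF clinear_funpow])
  have "subst_map T (\<lambda>y. subst_map S (\<lambda>x. f x y) p) q =
      subst_map T (\<lambda>y. \<Sum>n\<le>degree p. (S ^^ n) (f (coeff p n) y)) q"
    using assms(1) by (simp add: subst_map_bound[OF _ _ order_refl] lin)
  also have "\<dots> = (\<Sum>m\<le>degree q. \<Sum>n\<le>degree p. (T ^^ m) ((S ^^ n) (f (coeff p n) (coeff q m))))"
    using assms(1,2) by (subst subst_map_bound[OF _ _ order_refl])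
      (auto simp: lin clinear_sum[OF clinear_funpow] intro!: clinear_sum_fun clinear_compose[OF clinear_funpow])
  also have "\<dots> = (\<Sum>n\<le>degree p. \<Sum>m\<le>degree q. (S ^^ n) ((T ^^ m) (f (coeff p n) (coeff q m))))"
  proof (subst sum.swap, intro sum.cong refl)
    fix n m t
    have *: "(T ^^ m) (S t) = S ((T ^^ m) t)" for t
      by (induction m) (auto simp: assms(3))
    show "(T ^^ m) ((S ^^ n) t) = (S ^^ n) ((T ^^ m) t)" for t
      by (induction n) (auto simp: *)
  qed
  also have "\<dots> = subst_map S (\<lambda>x. subst_map T (\<lambda>y. f x y) q) p"
    by (subst subst_map_bound[OF assms(1) 1 order_refl])
      (simp only: subst_map_bound[OF assms(2) lin(2) order_refl] clinear_sum[OF clinear_funpow[OF assms(1)]])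
  finally show ?thesis by simp
qed

lemma subst_map_linear_param:
  assumes "clinear T" "\<And>y. clinear (\<lambda>x. f x y)" "\<And>x. clinear (f x)"
  shows "clinear (\<lambda>x. subst_map T (f x) p)"
  using assms by (auto simp: subst_map_bound[OF _ _ order_refl]
      intro!: clinear_sum_fun clinear_compose[OF clinear_funpow])

lemma subst_map_diff_fun:
  "clinear T \<Longrightarrow> clinear f \<Longrightarrow> clinear g \<Longrightarrow>
    subst_map T (\<lambda>x. f x - g x) p = subst_map T f p - subst_map T g p"
  by (simp add: subst_map_bound[OF _ _ order_refl] clinear_minus_fun clinear_diff[OF clinear_funpow] sum_subtractf)

lemma subst_map_minus_fun:
  "clinear T \<Longrightarrow> clinear f \<Longrightarrow> subst_map T (\<lambda>x. - f x) p = - subst_map T f p"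
  by (simp add: subst_map_bound[OF _ _ order_refl] clinear_uminus clinear_minus[OF clinear_funpow] sum_negf)

lemma clinear_const2: "clinear const2"
  unfolding const2_def using clinear_compose[OF clinear_pCons_const clinear_pCons_const] .

lemma clinear_lam: "clinear lam"
  unfolding lam_def by (rule clinear_pCons_0)

lemma clinear_mu: "clinear mu"
  unfolding mu_def by (intro clinear_map_poly clinear_pCons_0)

text \<open>Evaluating \<open>\<lambda>\<close> at \<open>S\<close> and \<open>\<mu>\<close> at \<open>T\<close> turns the formal left-symmetry axiom into identities
  between values in an arbitrary module.\<close>

lemma subst_map2_lam:
  "clinear S \<Longrightarrow> clinear T \<Longrightarrow> clinear f \<Longrightarrow>
    subst_map S (subst_map T f) (lam p) = S (subst_map S (subst_map T f) p)"
  by (simp add: lam_def subst_map_pCons_0 subst_map_linear)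

lemma subst_map2_mu:
  assumes "clinear S" "clinear T" "clinear f" "\<And>t. S (T t) = T (S t)"
  shows "subst_map S (subst_map T f) (mu p) = T (subst_map S (subst_map T f) p)"
  using assms
  by (simp add: mu_def subst_map_compose subst_map_linear clinear_pCons_0 subst_map_pCons_0
      subst_map_intertwine[of S S "subst_map T f" T])

lemma subst_map2_const2:
  "clinear S \<Longrightarrow> clinear T \<Longrightarrow> clinear f \<Longrightarrow> subst_map S (subst_map T f) (const2 x) = f x"
  by (simp add: const2_def subst_map_const subst_map_linear)

section \<open>Conformal products at operator arguments\<close>

context hom_left_symmetric_conformal_algebra
begin

abbreviation br :: "'a \<Rightarrow> 'a \<Rightarrow> 'a poly" where
  "br \<equiv> bracket D lp"

lemma lp_linear_left: "clinear f \<Longrightarrow> clinear (\<lambda>x. lp (f x) b)"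
  by (rule cbilinear_left[OF bilinear_lp])

lemma lp_linear_right: "clinear f \<Longrightarrow> clinear (\<lambda>x. lp a (f x))"
  by (rule cbilinear_right[OF bilinear_lp])

lemma clinear_bracket_variable: "clinear (\<lambda>q. - pCons 0 q - map_poly D q)"
  by (intro clinear_minus_fun clinear_uminus clinear_pCons_0 clinear_map_poly linear_D)

lemma bracket_eq: "br a b = lp a b - subst_map (\<lambda>q. - pCons 0 q - map_poly D q) (\<lambda>z. [:z:]) (lp b a)"
  by (simp add: bracket_def subst_map_def)

lemma bracket_linear_left: "clinear f \<Longrightarrow> clinear (\<lambda>x. br (f x) b)"
  unfolding bracket_eq
  by (intro clinear_minus_fun lp_linear_left clinear_compose[OF subst_map_linear] lp_linear_right
      clinear_bracket_variable clinear_pCons_const)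

lemma bracket_linear_right: "clinear f \<Longrightarrow> clinear (\<lambda>x. br a (f x))"
  unfolding bracket_eq
  by (intro clinear_minus_fun lp_linear_left clinear_compose[OF subst_map_linear] lp_linear_right
      clinear_bracket_variable clinear_pCons_const)

lemma subst_map_lp_linear_left:
  "clinear T \<Longrightarrow> clinear f \<Longrightarrow> clinear g \<Longrightarrow> clinear (\<lambda>x. subst_map T f (lp (g x) b))"
  by (intro clinear_compose[OF subst_map_linear] lp_linear_left)

lemma subst_map_lp_linear_right:
  "clinear T \<Longrightarrow> clinear f \<Longrightarrow> clinear g \<Longrightarrow> clinear (\<lambda>x. subst_map T f (lp a (g x)))"
  by (intro clinear_compose[OF subst_map_linear] lp_linear_right)

lemma subst_map_bracket_linear_left:
  "clinear T \<Longrightarrow> clinear f \<Longrightarrow> clinear g \<Longrightarrow> clinear (\<lambda>x. subst_map T f (br (g x) b))"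
  by (intro clinear_compose[OF subst_map_linear] bracket_linear_left)

lemma subst_map_bracket_linear_right:
  "clinear T \<Longrightarrow> clinear f \<Longrightarrow> clinear g \<Longrightarrow> clinear (\<lambda>x. subst_map T f (br a (g x)))"
  by (intro clinear_compose[OF subst_map_linear] bracket_linear_right)

lemmas subst_map_intros = subst_map_lp_linear_left subst_map_lp_linear_right
  subst_map_bracket_linear_left subst_map_bracket_linear_right subst_map_linear_param

lemma subst_map_lp_D_left:
  "clinear T \<Longrightarrow> clinear f \<Longrightarrow> subst_map T f (lp (D a) b) = - T (subst_map T f (lp a b))"
  by (simp add: lp_D_left clinear_minus[OF subst_map_linear]
      clinear_minus[of T] subst_map_pCons_0)

text \<open>\<open>U\<close> is what \<partial> on the value becomes after \<open>f\<close>. A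
  product evaluated at \<open>T\<close> has operator \<open>-T\<close> on its left factor,
  \<open>U + T\<close> on its right factor and \<open>U\<close> on its value.\<close>

lemma subst_map_lp_D_right:
  assumes "clinear T" "clinear f" "clinear U" "\<And>x. f (D x) = U (f x)" "\<And>t. U (T t) = T (U t)"
  shows "subst_map T f (lp a (D b)) = U (subst_map T f (lp a b)) + T (subst_map T f (lp a b))"
  using assms by (simp add: lp_D_right clinear_add[OF subst_map_linear] subst_map_pCons_0
      subst_map_compose linear_D subst_map_intertwine[of T T f U])

lemma subst_map_lp_alpha:
  "clinear T \<Longrightarrow> clinear f \<Longrightarrow> subst_map T f (lp (\<alpha> a) (\<alpha> b)) = subst_map T (\<lambda>x. f (\<alpha> x)) (lp a b)"
  by (simp add: alpha_lp[symmetric] subst_map_compose linear_alpha)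

text \<open>Evaluation at \<open>T\<close> intertwines the operator -\<lambda>-\<partial> on
  A[\<lambda>] with \<open>-T - U\<close>. The bracket thus splits into two products, the second
  with minus the operator carried by \<open>b\<close> as its variable.\<close>

lemma subst_map_bracket:
  assumes "clinear T" "clinear f" "clinear U" "clinear T'" "\<And>x. f (D x) = U (f x)"
    and "\<And>t. U (T t) = T (U t)" and T': "\<And>t. T' t = - T t - U t"
  shows "subst_map T f (br a b) = subst_map T f (lp a b) - subst_map T' f (lp b a)"
proof -
  have "subst_map T f (subst_map (\<lambda>q. - pCons 0 q - map_poly D q) (\<lambda>z. [:z:]) p)
      = subst_map T' (\<lambda>x. subst_map T f [:x:]) p" for p
  proof (rule subst_map_intertwine)
    fix q
    have "subst_map T f (map_poly D q) = U (subst_map T f q)"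
      using assms(1-6) by (simp add: subst_map_compose linear_D subst_map_intertwine[of T T f U])
    then show "subst_map T f (- pCons 0 q - map_poly D q) = T' (subst_map T f q)"
      using assms(1,2) by (simp add: clinear_diff[OF subst_map_linear] clinear_minus[OF subst_map_linear]
          clinear_minus[of T] subst_map_pCons_0 T')
  qed (intro assms clinear_bracket_variable clinear_pCons_const subst_map_linear)+
  then show ?thesis
    using assms(1,2) by (simp add: bracket_eq clinear_diff[OF subst_map_linear] subst_map_const)
qed

text \<open>Replacing \<open>T\<close> by \<open>-T - U\<close> twice returns \<open>T\<close>, so
  the two halves of the bracket trade places.\<close>

lemma subst_map_bracket_skew:
  assumes "clinear T" "clinear f" "clinear U" "clinear T'" "\<And>x. f (D x) = U (f x)"
    and "\<And>t. U (T t) = T (U t)" and T': "\<And>t. T' t = - T t - U t"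
  shows "subst_map T f (br a b) = - subst_map T' f (br b a)"
proof -
  have "subst_map T' f (br b a) = subst_map T' f (lp b a) - subst_map T f (lp a b)"
    by (rule subst_map_bracket[where U = U])
      (use assms in \<open>auto simp: T' clinear_diff clinear_minus\<close>)
  then show ?thesis
    by (simp add: subst_map_bracket[OF assms])
qed

lemma bracket_alpha: "map_poly \<alpha> (br a b) = br (\<alpha> a) (\<alpha> b)"
proof -
  have "map_poly \<alpha> (subst_map (\<lambda>q. - pCons 0 q - map_poly D q) (\<lambda>z. [:z:]) p) =
      subst_map (\<lambda>q. - pCons 0 q - map_poly D q) (\<lambda>z. map_poly \<alpha> [:z:]) p" for p
  proof (rule subst_map_intertwine)
    fix q
    have "map_poly \<alpha> (map_poly D q) = map_poly D (map_poly \<alpha> q)"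
      by (simp add: map_poly_map_poly clinear_0 linear_D linear_alpha comp_def alpha_D)
    then show "map_poly \<alpha> (- pCons 0 q - map_poly D q) = - pCons 0 (map_poly \<alpha> q) - map_poly D (map_poly \<alpha> q)"
      using linear_alpha
      by (simp add: clinear_diff[OF clinear_map_poly] clinear_minus[OF clinear_map_poly] map_poly_pCons clinear_0)
  qed (intro clinear_bracket_variable clinear_pCons_const clinear_map_poly linear_alpha)+
  then have "map_poly \<alpha> (subst_map (\<lambda>q. - pCons 0 q - map_poly D q) (\<lambda>z. [:z:]) p) =
      subst_map (\<lambda>q. - pCons 0 q - map_poly D q) (\<lambda>z. [:z:]) (map_poly \<alpha> p)" for p
    using linear_alpha
    by (simp add: map_poly_pCons clinear_0 subst_map_compose[OF clinear_bracket_variable clinear_pCons_const]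
        del: minus_pCons)
  then show ?thesis
    by (simp only: bracket_eq clinear_diff[OF clinear_map_poly[OF linear_alpha]] alpha_lp)
qed

lemma subst_map_bracket_alpha:
  "clinear T \<Longrightarrow> clinear f \<Longrightarrow> subst_map T f (br (\<alpha> a) (\<alpha> b)) = subst_map T (\<lambda>x. f (\<alpha> x)) (br a b)"
  by (simp add: bracket_alpha[symmetric] subst_map_compose linear_alpha)

text \<open>\<open>X\<close> is formal multiplication by an element of \<complex>[\<lambda>,\<mu>]
  and \<open>X'\<close> its value once both variables are evaluated; below, \<open>X\<close> is
  \<open>lam\<close>, \<open>mu\<close> or their sum.\<close>

lemma subst_map2_prod_at:
  assumes "clinear S" "clinear T" "clinear f" "clinear X" "clinear X'"
    and "\<And>p. subst_map S (subst_map T f) (X p) = X' (subst_map S (subst_map T f) p)"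
  shows "subst_map S (subst_map T f) (prod_at lp X a b) = subst_map X' f (lp a b)"
  using subst_map_intertwine[of X X' const2 "subst_map S (subst_map T f)" "lp a b"] assms
  by (simp add: prod_at_def subst_map_def[symmetric] subst_map_linear subst_map2_const2 clinear_const2)

lemma prod_at_linear_left: "clinear X \<Longrightarrow> clinear (\<lambda>z. prod_at lp X z c)"
  unfolding prod_at_def subst_map_def[symmetric]
  by (intro clinear_compose[OF subst_map_linear] clinear_const2 lp_linear_left clinear_ident)

lemma prod_at_linear_right: "clinear X \<Longrightarrow> clinear (\<lambda>z. prod_at lp X a z)"
  unfolding prod_at_def subst_map_def[symmetric]
  by (intro clinear_compose[OF subst_map_linear] clinear_const2 lp_linear_right clinear_ident)

lemma subst_map2_prod_left:
  assumes "clinear S" "clinear T" "clinear f" "clinear X" "clinear X'" "\<And>t. S (T t) = T (S t)"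
    and "\<And>p. subst_map S (subst_map T f) (X p) = X' (subst_map S (subst_map T f) p)"
  shows "subst_map S (subst_map T f) (prod_left lp X a b c) =
    subst_map X' (\<lambda>z. subst_map (\<lambda>t. S t + T t) f (lp z c)) (lp a b)"
proof -
  have "subst_map S (subst_map T f) (prod_at lp (\<lambda>q. lam q + mu q) z c) =
      subst_map (\<lambda>t. S t + T t) f (lp z c)" for z
    using assms by (intro subst_map2_prod_at)
      (auto intro: clinear_plus clinear_lam clinear_mu
        simp: clinear_add[OF subst_map_linear] subst_map_linear subst_map2_lam subst_map2_mu)
  moreover have "clinear (\<lambda>q. lam q + mu q)"
    by (intro clinear_plus clinear_lam clinear_mu)
  ultimately show ?thesis
    using subst_map_intertwine[OF assms(4,5) prod_at_linear_left
        subst_map_linear[OF assms(1) subst_map_linear[OF assms(2,3)]] assms(7),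
        of "\<lambda>q. lam q + mu q" c "lp a b"]
    by (simp add: prod_left_def subst_map_def[symmetric])
qed

lemma subst_map2_prod_right:
  assumes "clinear S" "clinear T" "clinear f" "clinear X" "clinear X'" "clinear Y" "clinear Y'"
    and "\<And>p. subst_map S (subst_map T f) (X p) = X' (subst_map S (subst_map T f) p)"
    and "\<And>p. subst_map S (subst_map T f) (Y p) = Y' (subst_map S (subst_map T f) p)"
  shows "subst_map S (subst_map T f) (prod_right lp X Y a b c) =
    subst_map Y' (\<lambda>z. subst_map X' f (lp a z)) (lp b c)"
  using subst_map_intertwine[OF assms(6,7) prod_at_linear_right
        subst_map_linear[OF assms(1) subst_map_linear[OF assms(2,3)]] assms(9),
        of X a "lp b c"]
  by (simp add: prod_right_def subst_map_def[symmetric] assms(4) subst_map2_prod_at[OF assms(1-5,8)])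

text \<open>The axiom at \<lambda> = \<open>S\<close>, \<mu> = \<open>T\<close>. \<open>W\<close> is
  a separate operator because in applications \<open>S + T\<close> appears in reduced form, for
  example \<open>N0 + O1\<close> as \<open>N1\<close>.\<close>

lemma left_symmetric_subst:
  assumes S: "clinear S" and T: "clinear T" and f: "clinear f" and comm: "\<And>t. S (T t) = T (S t)"
    and W: "\<And>t. W t = S t + T t"
  shows "subst_map S (\<lambda>z. subst_map W f (lp z (\<alpha> c))) (lp a b)
      - subst_map T (\<lambda>z. subst_map S f (lp (\<alpha> a) z)) (lp b c)
    = subst_map T (\<lambda>z. subst_map W f (lp z (\<alpha> c))) (lp b a)
      - subst_map S (\<lambda>z. subst_map T f (lp (\<alpha> b) z)) (lp a c)"
proof -
  have "W = (\<lambda>t. S t + T t)"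
    using W by blast
  moreover note lam = clinear_lam S subst_map2_lam[OF S T f]
    and mu = clinear_mu T subst_map2_mu[OF S T f comm]
  ultimately show ?thesis
    using arg_cong[OF left_symmetric[of a b c], of "subst_map S (subst_map T f)"]
    by (simp add: clinear_diff[OF subst_map_linear[OF S subst_map_linear[OF T f]]]
        subst_map2_prod_left[OF S T f lam(1,2) comm lam(3)] subst_map2_prod_left[OF S T f mu(1,2) comm mu(3)]
        subst_map2_prod_right[OF S T f lam(1,2) mu(1,2) lam(3) mu(3)]
        subst_map2_prod_right[OF S T f mu(1,2) lam(1,2) mu(3) lam(3)])
qed

text \<open>With \<open>C = - S - T - U\<close> the variables attached to \<open>a\<close>, \<open>x\<close>, \<open>y\<close> are \<open>S\<close>, \<open>T\<close>, \<open>C\<close>; this makes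
  the computation literally that of the Jacobi identity for an ordinary left-symmetric algebra.\<close>

lemma bracket_jacobi_subst:
  assumes S: "clinear S" and T: "clinear T" and U: "clinear U" and f: "clinear f"
    and ST: "\<And>t. S (T t) = T (S t)" and US: "\<And>t. U (S t) = S (U t)" and UT: "\<And>t. U (T t) = T (U t)"
    and fD: "\<And>x. f (D x) = U (f x)"
    and W: "\<And>t. W t = S t + T t" and X: "\<And>t. X t = - T t - U t"
  shows "subst_map T (\<lambda>z. subst_map S f (br (\<alpha> a) z)) (br x y) =
    subst_map S (\<lambda>z. subst_map W f (br z (\<alpha> y))) (br a x)
    - subst_map S (\<lambda>z. subst_map X f (br z (\<alpha> x))) (br a y)"
proof -
  define C where "C t = - S t - T t - U t" for t
  define V where "V t = - S t - U t" for t
  note lin = clinear_ident clinear_minus_fun clinear_uminus clinear_plus S T U f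
  have W': "clinear W" and X': "clinear X" and C: "clinear C" and V: "clinear V"
    unfolding W[abs_def] X[abs_def] C_def[abs_def] V_def[abs_def] by (intro lin)+
  note maps = S T U W' X' C V f
  note ops = W X C_def V_def ST US UT clinear_add[OF S] clinear_add[OF T] clinear_add[OF U]
    clinear_diff[OF S] clinear_diff[OF T] clinear_diff[OF U]
    clinear_minus[OF S] clinear_minus[OF T] clinear_minus[OF U]
  have br_S: "subst_map S f (br a b) = subst_map S f (lp a b) - subst_map V f (lp b a)" for a b
    by (rule subst_map_bracket[OF S f U V fD]) (simp_all add: ops)
  have br_W: "subst_map W f (br a b) = subst_map W f (lp a b) - subst_map C f (lp b a)" for a b
    by (rule subst_map_bracket[OF W' f U C fD]) (simp_all add: ops)
  have br_X: "subst_map X f (br a b) = subst_map X f (lp a b) - subst_map T f (lp b a)" for a b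
    by (rule subst_map_bracket[OF X' f U T fD]) (simp_all add: ops)
  have UC: "U (C t) = C (U t)" for t
    by (simp add: ops)
  note D_right = subst_map_lp_D_right[OF S f U fD US] subst_map_lp_D_right[OF T f U fD UT]
  have "U t + C t = - S t - T t" for t
    by (simp add: C_def)
  note D_right_C = subst_map_lp_D_right[OF C f U fD UC, unfolded this]
  \<comment> \<open>In each of the six inner brackets, the \<open>U\<close> supplied is the operator
    on the slot of \<open>z\<close> in the outer product: minus the variable if \<open>z\<close> is
    the left factor, value plus variable if it is the right factor.\<close>
  have br1: "subst_map T (\<lambda>z. subst_map S f (lp (\<alpha> a) z)) (br x y) =
      subst_map T (\<lambda>z. subst_map S f (lp (\<alpha> a) z)) (lp x y)
      - subst_map C (\<lambda>z. subst_map S f (lp (\<alpha> a) z)) (lp y x)"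
    by (rule subst_map_bracket[where U = "\<lambda>t. U t + S t"])
      (auto intro!: lin subst_map_intros maps simp: D_right ops)
  have br2: "subst_map T (\<lambda>z. subst_map V f (lp z (\<alpha> a))) (br x y) =
      subst_map T (\<lambda>z. subst_map V f (lp z (\<alpha> a))) (lp x y)
      - subst_map C (\<lambda>z. subst_map V f (lp z (\<alpha> a))) (lp y x)"
    by (rule subst_map_bracket[where U = "\<lambda>t. U t + S t"])
      (auto intro!: lin subst_map_intros maps simp: subst_map_lp_D_left[OF V f] ops)
  have br3: "subst_map S (\<lambda>z. subst_map W f (lp z (\<alpha> y))) (br a x) =
      subst_map S (\<lambda>z. subst_map W f (lp z (\<alpha> y))) (lp a x)
      - subst_map T (\<lambda>z. subst_map W f (lp z (\<alpha> y))) (lp x a)"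
    by (rule subst_map_bracket[where U = "\<lambda>t. - S t - T t"])
      (auto intro!: lin subst_map_intros maps simp: subst_map_lp_D_left[OF W' f] ops)
  have br4: "subst_map S (\<lambda>z. subst_map C f (lp (\<alpha> y) z)) (br a x) =
      subst_map S (\<lambda>z. subst_map C f (lp (\<alpha> y) z)) (lp a x)
      - subst_map T (\<lambda>z. subst_map C f (lp (\<alpha> y) z)) (lp x a)"
    by (rule subst_map_bracket[where U = "\<lambda>t. - S t - T t"])
      (auto intro!: lin subst_map_intros maps simp: D_right_C ops)
  have br5: "subst_map S (\<lambda>z. subst_map X f (lp z (\<alpha> x))) (br a y) =
      subst_map S (\<lambda>z. subst_map X f (lp z (\<alpha> x))) (lp a y)
      - subst_map C (\<lambda>z. subst_map X f (lp z (\<alpha> x))) (lp y a)"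
    by (rule subst_map_bracket[where U = "\<lambda>t. U t + T t"])
      (auto intro!: lin subst_map_intros maps simp: subst_map_lp_D_left[OF X' f] ops)
  have br6: "subst_map S (\<lambda>z. subst_map T f (lp (\<alpha> x) z)) (br a y) =
      subst_map S (\<lambda>z. subst_map T f (lp (\<alpha> x) z)) (lp a y)
      - subst_map C (\<lambda>z. subst_map T f (lp (\<alpha> x) z)) (lp y a)"
    by (rule subst_map_bracket[where U = "\<lambda>t. U t + T t"])
      (auto intro!: lin subst_map_intros maps simp: D_right ops)
  have 1: "subst_map T (\<lambda>z. subst_map S f (br (\<alpha> a) z)) (br x y) =
      subst_map T (\<lambda>z. subst_map S f (lp (\<alpha> a) z)) (br x y)
      - subst_map T (\<lambda>z. subst_map V f (lp z (\<alpha> a))) (br x y)"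
    unfolding br_S by (intro subst_map_diff_fun subst_map_intros maps clinear_ident)
  have 2: "subst_map S (\<lambda>z. subst_map W f (br z (\<alpha> y))) (br a x) =
      subst_map S (\<lambda>z. subst_map W f (lp z (\<alpha> y))) (br a x)
      - subst_map S (\<lambda>z. subst_map C f (lp (\<alpha> y) z)) (br a x)"
    unfolding br_W by (intro subst_map_diff_fun subst_map_intros maps clinear_ident)
  have 3: "subst_map S (\<lambda>z. subst_map X f (br z (\<alpha> x))) (br a y) =
      subst_map S (\<lambda>z. subst_map X f (lp z (\<alpha> x))) (br a y)
      - subst_map S (\<lambda>z. subst_map T f (lp (\<alpha> x) z)) (br a y)"
    unfolding br_X by (intro subst_map_diff_fun subst_map_intros maps clinear_ident)
  \<comment> \<open>Left symmetry for each pair from \<open>a\<close>, \<open>x\<close>,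
    \<open>y\<close>, acting on the remaining element. The variables are \<open>S\<close>,
    \<open>T\<close>, \<open>C\<close>, with \<open>S + T = W\<close>, \<open>S + C = X\<close> and
    \<open>T + C = V\<close>.\<close>
  note ls = left_symmetric_subst[OF S T f, of W y a x] left_symmetric_subst[OF S C f, of X x a y]
    left_symmetric_subst[OF T C f, of V a x y]
  show ?thesis
    unfolding 1 2 3 br1 br2 br3 br4 br5 br6
    using ls by (simp add: ops algebra_simps)
qed

end

lemma subst_map_add_fun:
  "clinear T \<Longrightarrow> clinear f \<Longrightarrow> clinear g \<Longrightarrow>
    subst_map T (\<lambda>x. f x + g x) p = subst_map T f p + subst_map T g p"
  by (simp add: subst_map_bound[OF _ _ order_refl] clinear_plus clinear_add[OF clinear_funpow] sum.distrib)

section \<open>Operators on the three tensor slots and the action of a\<close>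

lemma D_1_tensor: "clinear D \<Longrightarrow> D_1 D (x \<otimes> y \<otimes> z) = D x \<otimes> y \<otimes> z"
  and D_2_tensor: "clinear D \<Longrightarrow> D_2 D (x \<otimes> y \<otimes> z) = x \<otimes> D y \<otimes> z"
  and D_3_tensor: "clinear D \<Longrightarrow> D_3 D (x \<otimes> y \<otimes> z) = x \<otimes> y \<otimes> D z"
  by (simp_all add: D_1_def D_2_def D_3_def tensor_map_tensor tensor_map_linear clinear_id)

lemma D_1_linear: "clinear D \<Longrightarrow> clinear (D_1 D)"
  and D_2_linear: "clinear D \<Longrightarrow> clinear (D_2 D)"
  and D_3_linear: "clinear D \<Longrightarrow> clinear (D_3 D)"
  by (simp_all add: D_1_def D_2_def D_3_def tensor_map_linear clinear_id)

lemma D_tensor2_linear: "clinear D \<Longrightarrow> clinear (D_tensor2 D)"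
  unfolding D_tensor2_def[abs_def] by (intro clinear_plus tensor_map_linear clinear_id)

lemma D_tensor2_tensor: "clinear D \<Longrightarrow> D_tensor2 D (x \<otimes> y) = D x \<otimes> y + x \<otimes> D y"
  by (simp add: D_tensor2_def tensor_map_tensor clinear_id)

context hom_left_symmetric_conformal_algebra
begin

abbreviation "O1 \<equiv> D_1 D"
abbreviation "O2 \<equiv> D_2 D"
abbreviation "O3 \<equiv> D_3 D"

text \<open>\<open>N0\<close> is the variable of a product with a. \<open>N1\<close>,
  \<open>N2\<close>, \<open>N3\<close> equal \<open>N0\<close> plus \<partial> on the respective
  slot: the operator on that slot before a acts there. \<open>N1\<close> and \<open>N3\<close> are
  also the variables of the inner \<delta> in \<alpha> \<otimes> \<delta> and \<delta> \<otimes>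
  \<alpha>.\<close>

definition N0 :: "'a \<otimes> 'a \<otimes> 'a \<Rightarrow> 'a \<otimes> 'a \<otimes> 'a" where "N0 t = - D_tensor3 D t"
definition N1 :: "'a \<otimes> 'a \<otimes> 'a \<Rightarrow> 'a \<otimes> 'a \<otimes> 'a" where "N1 t = - (O2 t + O3 t)"
definition N2 :: "'a \<otimes> 'a \<otimes> 'a \<Rightarrow> 'a \<otimes> 'a \<otimes> 'a" where "N2 t = - (O1 t + O3 t)"
definition N3 :: "'a \<otimes> 'a \<otimes> 'a \<Rightarrow> 'a \<otimes> 'a \<otimes> 'a" where "N3 t = - (O1 t + O2 t)"

lemmas O_linear = D_1_linear[OF linear_D] D_2_linear[OF linear_D] D_3_linear[OF linear_D]
lemmas O_tensor = D_1_tensor[OF linear_D] D_2_tensor[OF linear_D] D_3_tensor[OF linear_D]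

lemma N_linear: "clinear N0" "clinear N1" "clinear N2" "clinear N3"
  unfolding N0_def[abs_def] D_tensor3_def N1_def[abs_def] N2_def[abs_def] N3_def[abs_def]
  by (intro clinear_uminus clinear_plus O_linear)+

lemma O_commute: "O2 (O1 t) = O1 (O2 t)" "O3 (O1 t) = O1 (O3 t)" "O3 (O2 t) = O2 (O3 t)"
  by (rule tensor3_eqI[where t = t]; simp add: clinear_compose O_linear O_tensor)+

lemmas operator_simps = N0_def D_tensor3_def N1_def N2_def N3_def O_commute
  O_linear[THEN clinear_add] O_linear[THEN clinear_minus] O_linear[THEN clinear_diff]

lemmas linear_simps = clinear_ident linear_alpha linear_D O_linear N_linear tau12_linear
  clinear_compose[OF linear_alpha] clinear_compose[OF tau12_linear] clinear_plus clinear_minus_fun clinear_uminus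
  clinear_tensor_left clinear_tensor_right clinear_tensor_right[OF clinear_ident]
  subst_map_linear_param subst_map_linear subst_map_lp_linear_left subst_map_lp_linear_right
  subst_map_lp_linear_left[OF _ _ clinear_ident] subst_map_lp_linear_right[OF _ _ clinear_ident]
  subst_map_bracket_linear_left subst_map_bracket_linear_right
  subst_map_bracket_linear_left[OF _ _ clinear_ident] subst_map_bracket_linear_right[OF _ _ clinear_ident]
  clinear_compose[OF O_linear(1)] clinear_compose[OF O_linear(2)] clinear_compose[OF O_linear(3)]
  clinear_compose[OF N_linear(1)] clinear_compose[OF N_linear(2)] clinear_compose[OF N_linear(3)]
  clinear_compose[OF N_linear(4)]

text \<open>\<open>Qk a t\<close> is \<open>\<alpha>\<^sup>\<otimes>\<^sup>3\<close> applied to the summand of \<open>Q(a)\<^sub>\<lambda> t\<close>, at \<open>\<lambda> = -\<partial>\<^sup>\<otimes>\<^sup>3\<close>, in which \<open>a\<close> acts on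
  the \<open>k\<close>-th tensor factor.\<close>

definition Q1 :: "'a \<Rightarrow> 'a \<otimes> 'a \<otimes> 'a \<Rightarrow> 'a \<otimes> 'a \<otimes> 'a" where
  "Q1 a t = tensor_map (tensor_map \<alpha> \<alpha>) \<alpha> (subst_op N0 (poly_tensor (poly_tensor (lp a) \<alpha>) \<alpha> t))"

definition Q2 :: "'a \<Rightarrow> 'a \<otimes> 'a \<otimes> 'a \<Rightarrow> 'a \<otimes> 'a \<otimes> 'a" where
  "Q2 a t = tensor_map (tensor_map \<alpha> \<alpha>) \<alpha> (subst_op N0 (poly_tensor (tensor_poly \<alpha> (lp a)) \<alpha> t))"

definition Q3 :: "'a \<Rightarrow> 'a \<otimes> 'a \<otimes> 'a \<Rightarrow> 'a \<otimes> 'a \<otimes> 'a" where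
  "Q3 a t = tensor_map (tensor_map \<alpha> \<alpha>) \<alpha> (subst_op N0 (tensor_poly (tensor_map \<alpha> \<alpha>) (br a) t))"

lemma lp_linear: "clinear (lp a)"
  using lp_linear_right[OF clinear_ident] .

lemma br_linear: "clinear (br a)"
  using bracket_linear_right[OF clinear_ident] .

lemma alpha3_linear: "clinear (tensor_map (tensor_map \<alpha> \<alpha>) \<alpha>)"
  by (intro tensor_map_linear linear_alpha)

lemma alpha3_tensor: "tensor_map (tensor_map \<alpha> \<alpha>) \<alpha> (x \<otimes> y \<otimes> z) = \<alpha> x \<otimes> \<alpha> y \<otimes> \<alpha> z"
  by (simp add: tensor_map_tensor tensor_map_linear linear_alpha)

lemma alpha3_O: "tensor_map (tensor_map \<alpha> \<alpha>) \<alpha> (O1 t) = O1 (tensor_map (tensor_map \<alpha> \<alpha>) \<alpha> t)"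
  "tensor_map (tensor_map \<alpha> \<alpha>) \<alpha> (O2 t) = O2 (tensor_map (tensor_map \<alpha> \<alpha>) \<alpha> t)"
  "tensor_map (tensor_map \<alpha> \<alpha>) \<alpha> (O3 t) = O3 (tensor_map (tensor_map \<alpha> \<alpha>) \<alpha> t)"
  by (rule tensor3_eqI[where t = t];
      simp add: clinear_compose[OF alpha3_linear] clinear_compose O_linear O_tensor alpha3_linear alpha3_tensor alpha_D)+

lemma alpha3_N0: "tensor_map (tensor_map \<alpha> \<alpha>) \<alpha> (N0 t) = N0 (tensor_map (tensor_map \<alpha> \<alpha>) \<alpha> t)"
  by (simp add: N0_def D_tensor3_def clinear_minus[OF alpha3_linear] clinear_add[OF alpha3_linear]
      clinear_diff[OF alpha3_linear] alpha3_O)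

lemma Q_linear: "clinear (Q1 a)" "clinear (Q2 a)" "clinear (Q3 a)"
  unfolding Q1_def[abs_def] Q2_def[abs_def] Q3_def[abs_def]
  by (intro clinear_compose[OF alpha3_linear] clinear_compose[OF subst_op_linear] N_linear
      poly_tensor_linear tensor_poly_linear lp_linear br_linear linear_alpha tensor_map_linear)+

lemma subst_map_alpha3: "clinear f \<Longrightarrow> tensor_map (tensor_map \<alpha> \<alpha>) \<alpha> (subst_map N0 f p) =
    subst_map N0 (\<lambda>x. tensor_map (tensor_map \<alpha> \<alpha>) \<alpha> (f x)) p"
  by (intro subst_map_intertwine N_linear alpha3_linear alpha3_N0)

lemma Q1_tensor: "Q1 a (x \<otimes> y \<otimes> z) = subst_map N0 (\<lambda>w. \<alpha> w \<otimes> \<alpha> (\<alpha> y) \<otimes> \<alpha> (\<alpha> z)) (lp a x)"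
proof -
  have "Q1 a (x \<otimes> y \<otimes> z) = tensor_map (tensor_map \<alpha> \<alpha>) \<alpha> (subst_map N0 (\<lambda>w. w \<otimes> \<alpha> y \<otimes> \<alpha> z) (lp a x))"
    by (simp add: Q1_def poly_tensor_tensor poly_tensor_linear lp_linear linear_alpha)
      (simp add: subst_map_def[symmetric] subst_map_compose linear_simps)
  also have "\<dots> = subst_map N0 (\<lambda>w. \<alpha> w \<otimes> \<alpha> (\<alpha> y) \<otimes> \<alpha> (\<alpha> z)) (lp a x)"
    by (simp add: linear_simps alpha3_tensor subst_map_alpha3)
  finally show ?thesis .
qed

lemma Q2_tensor: "Q2 a (x \<otimes> y \<otimes> z) = subst_map N0 (\<lambda>w. \<alpha> (\<alpha> x) \<otimes> \<alpha> w \<otimes> \<alpha> (\<alpha> z)) (lp a y)"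
proof -
  have "Q2 a (x \<otimes> y \<otimes> z) = tensor_map (tensor_map \<alpha> \<alpha>) \<alpha> (subst_map N0 (\<lambda>w. \<alpha> x \<otimes> w \<otimes> \<alpha> z) (lp a y))"
    by (simp add: Q2_def poly_tensor_tensor tensor_poly_tensor tensor_poly_linear lp_linear linear_alpha)
      (simp add: subst_map_def[symmetric] subst_map_compose linear_simps)
  also have "\<dots> = subst_map N0 (\<lambda>w. \<alpha> (\<alpha> x) \<otimes> \<alpha> w \<otimes> \<alpha> (\<alpha> z)) (lp a y)"
    by (simp add: linear_simps alpha3_tensor subst_map_alpha3)
  finally show ?thesis .
qed

lemma Q3_tensor: "Q3 a (x \<otimes> y \<otimes> z) = subst_map N0 (\<lambda>w. \<alpha> (\<alpha> x) \<otimes> \<alpha> (\<alpha> y) \<otimes> \<alpha> w) (br a z)"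
proof -
  have "Q3 a (x \<otimes> y \<otimes> z) = tensor_map (tensor_map \<alpha> \<alpha>) \<alpha> (subst_map N0 (\<lambda>w. \<alpha> x \<otimes> \<alpha> y \<otimes> w) (br a z))"
    by (simp add: Q3_def tensor_poly_tensor tensor_map_tensor tensor_map_linear br_linear linear_alpha
        subst_map_def)
  also have "\<dots> = subst_map N0 (\<lambda>w. \<alpha> (\<alpha> x) \<otimes> \<alpha> (\<alpha> y) \<otimes> \<alpha> w) (br a z)"
    by (simp add: linear_simps alpha3_tensor subst_map_alpha3)
  finally show ?thesis .
qed

lemmas Q_tensor = Q1_tensor Q2_tensor Q3_tensor

text \<open>In the swapped product \<partial> falls on the right factor and gives \<partial> plus
  the variable -\<lambda>-\<partial>, which is again -\<lambda>.\<close>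

lemma bracket_D_left: "br (D a) b = - pCons 0 (br a b)"
proof -
  let ?Z = "\<lambda>q. - pCons 0 q - map_poly D q"
  have 1: "subst_map ?Z (\<lambda>z. [:z:]) (map_poly D p) = map_poly D (subst_map ?Z (\<lambda>z. [:z:]) p)" for p
  proof -
    have "map_poly D (?Z q) = ?Z (map_poly D q)" for q
      using linear_D by (simp only: clinear_diff[OF clinear_map_poly] clinear_minus[OF clinear_map_poly]
          map_poly_pCons clinear_0)
    then have "map_poly D (subst_map ?Z (\<lambda>z. [:z:]) p) = subst_map ?Z (\<lambda>z. map_poly D [:z:]) p"
      by (intro subst_map_intertwine clinear_bracket_variable clinear_pCons_const clinear_map_poly linear_D)
    then show ?thesis
      by (simp only: map_poly_pCons clinear_0[OF linear_D] map_poly_0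
          subst_map_compose[OF clinear_bracket_variable clinear_pCons_const linear_D])
  qed
  show ?thesis
    by (simp only: bracket_eq lp_D_left lp_D_right 1 clinear_add[OF subst_map_linear[OF clinear_bracket_variable clinear_pCons_const]]
        subst_map_pCons_0[OF clinear_bracket_variable clinear_pCons_const]) simp
qed

lemma subst_map_bracket_D_left:
  "clinear T \<Longrightarrow> clinear f \<Longrightarrow> subst_map T f (br (D a) b) = - T (subst_map T f (br a b))"
  by (simp add: bracket_D_left clinear_minus[OF subst_map_linear] clinear_minus[of T] subst_map_pCons_0
      del: minus_pCons)

lemma bracket_D_right: "br a (D b) = map_poly D (br a b) + pCons 0 (br a b)"
proof -
  let ?Z = "\<lambda>q. - pCons 0 q - map_poly D q"
  have "subst_map ?Z (\<lambda>z. [:z:]) (- pCons 0 p) = map_poly D (subst_map ?Z (\<lambda>z. [:z:]) p)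
      + pCons 0 (subst_map ?Z (\<lambda>z. [:z:]) p)" for p
    by (simp add: clinear_minus[OF subst_map_linear[OF clinear_bracket_variable clinear_pCons_const]]
        subst_map_pCons_0[OF clinear_bracket_variable clinear_pCons_const] del: minus_pCons)
  then show ?thesis
    by (simp only: bracket_eq lp_D_left lp_D_right clinear_diff[OF clinear_map_poly[OF linear_D]]
       clinear_diff[OF clinear_pCons_0]) simp
qed

lemma subst_map_bracket_D_right:
  assumes "clinear T" "clinear f" "clinear U" "\<And>x. f (D x) = U (f x)" "\<And>t. U (T t) = T (U t)"
  shows "subst_map T f (br a (D b)) = U (subst_map T f (br a b)) + T (subst_map T f (br a b))"
  using assms by (simp add: bracket_D_right clinear_add[OF subst_map_linear] subst_map_pCons_0
      subst_map_compose linear_D subst_map_intertwine[of T T f U])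

lemma operator_commute_N0: "O1 (N0 t) = N0 (O1 t)" "O2 (N0 t) = N0 (O2 t)" "O3 (N0 t) = N0 (O3 t)"
  by (simp_all add: operator_simps)

lemma subst_map_N0_O:
  assumes "clinear f"
  shows "O1 (subst_map N0 f p) = subst_map N0 (\<lambda>x. O1 (f x)) p"
    "O2 (subst_map N0 f p) = subst_map N0 (\<lambda>x. O2 (f x)) p"
    "O3 (subst_map N0 f p) = subst_map N0 (\<lambda>x. O3 (f x)) p"
  by (intro subst_map_intertwine N_linear O_linear operator_commute_N0 assms)+

text \<open>On the slot where a acts, sesquilinearity turns \<partial> into \<partial> plus
  \<open>N0\<close>, which is \<open>N1\<close>, \<open>N2\<close> or \<open>N3\<close>. The other
  slots only meet \<alpha>, which commutes with \<partial>.\<close>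

lemma Q_O_tensor:
  "Q1 a (O1 (x \<otimes> y \<otimes> z)) = N1 (Q1 a (x \<otimes> y \<otimes> z))"
  "Q1 a (O2 (x \<otimes> y \<otimes> z)) = O2 (Q1 a (x \<otimes> y \<otimes> z))"
  "Q1 a (O3 (x \<otimes> y \<otimes> z)) = O3 (Q1 a (x \<otimes> y \<otimes> z))"
  "Q2 a (O1 (x \<otimes> y \<otimes> z)) = O1 (Q2 a (x \<otimes> y \<otimes> z))"
  "Q2 a (O2 (x \<otimes> y \<otimes> z)) = N2 (Q2 a (x \<otimes> y \<otimes> z))"
  "Q2 a (O3 (x \<otimes> y \<otimes> z)) = O3 (Q2 a (x \<otimes> y \<otimes> z))"
  "Q3 a (O1 (x \<otimes> y \<otimes> z)) = O1 (Q3 a (x \<otimes> y \<otimes> z))"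
  "Q3 a (O2 (x \<otimes> y \<otimes> z)) = O2 (Q3 a (x \<otimes> y \<otimes> z))"
  "Q3 a (O3 (x \<otimes> y \<otimes> z)) = N3 (Q3 a (x \<otimes> y \<otimes> z))"
  unfolding O_tensor Q_tensor
  by (simp_all add: linear_simps O_tensor alpha_D operator_commute_N0
      subst_map_lp_D_right[OF _ _ O_linear(1)] subst_map_lp_D_right[OF _ _ O_linear(2)]
      subst_map_bracket_D_right[OF _ _ O_linear(3)] subst_map_N0_O)
    (simp_all add: operator_simps subst_map_N0_O linear_simps O_tensor alpha_D)

lemma Q_O:
  "Q1 a (O1 t) = N1 (Q1 a t)" "Q1 a (O2 t) = O2 (Q1 a t)" "Q1 a (O3 t) = O3 (Q1 a t)"
  "Q2 a (O1 t) = O1 (Q2 a t)" "Q2 a (O2 t) = N2 (Q2 a t)" "Q2 a (O3 t) = O3 (Q2 a t)"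
  "Q3 a (O1 t) = O1 (Q3 a t)" "Q3 a (O2 t) = O2 (Q3 a t)" "Q3 a (O3 t) = N3 (Q3 a t)"
  by (rule tensor3_eqI[where t = t];
      intro clinear_compose[OF Q_linear(1)] clinear_compose[OF Q_linear(2)] clinear_compose[OF Q_linear(3)]
        clinear_compose[OF N_linear(2)] clinear_compose[OF N_linear(3)] clinear_compose[OF N_linear(4)]
        clinear_compose[OF O_linear(1)] clinear_compose[OF O_linear(2)] clinear_compose[OF O_linear(3)]
        Q_linear O_linear Q_O_tensor)+

text \<open>Gives the new variables when a acts on a summand of [[r,r]]: a variable located on the
  slot hit by a changes, any other is kept.\<close>

lemma Q_subst_map:
  assumes "clinear f"
  shows "Q1 a (subst_map O1 f p) = subst_map N1 (\<lambda>x. Q1 a (f x)) p"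
    "Q1 a (subst_map O3 f p) = subst_map O3 (\<lambda>x. Q1 a (f x)) p"
    "Q2 a (subst_map O1 f p) = subst_map O1 (\<lambda>x. Q2 a (f x)) p"
    "Q2 a (subst_map O3 f p) = subst_map O3 (\<lambda>x. Q2 a (f x)) p"
    "Q3 a (subst_map O1 f p) = subst_map O1 (\<lambda>x. Q3 a (f x)) p"
    "Q3 a (subst_map O3 f p) = subst_map N3 (\<lambda>x. Q3 a (f x)) p"
  by (intro subst_map_intertwine Q_linear O_linear N_linear Q_O assms)+

text \<open>The summands of the three tensors in the claim, as functions of the factors \<open>x \<otimes> y\<close>, \<open>x' \<otimes> y'\<close> of two
  copies of \<open>r\<close>: \<open>B1\<close>, \<open>B3\<close>, \<open>B5\<close> come from \<open>[[r,r]]\<close>, \<open>E1\<close>, \<dots>, \<open>E8\<close> from the coassociator, \<open>E5\<close> and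
  \<open>M2\<close>, \<dots>, \<open>M6\<close> from \<open>M(a)\<close>; \<open>Z1\<close> and \<open>Z2\<close> are intermediate.\<close>

definition "B1 x y x' y' = subst_map O3 (\<lambda>z. z \<otimes> \<alpha> y' \<otimes> \<alpha> y) (lp x x')"
definition "B3 x y x' y' = subst_map O1 (\<lambda>z. \<alpha> x' \<otimes> z \<otimes> \<alpha> y) (br y' x)"
definition "B5 x y x' y' = subst_map O1 (\<lambda>z. \<alpha> x \<otimes> \<alpha> x' \<otimes> z) (br y y')"

definition "E1 a x y x' y' = subst_map N0 (\<lambda>p. subst_map N1 (\<lambda>z. \<alpha> p \<otimes> z \<otimes> \<alpha> y') (lp (\<alpha> y) x')) (lp a x)"
definition "E2 a x y x' y' = subst_map N0 (\<lambda>p. subst_map N1 (\<lambda>z. \<alpha> p \<otimes> \<alpha> x' \<otimes> z) (br (\<alpha> y) y')) (lp a x)"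
definition "E3 a x y x' y' = subst_map N0 (\<lambda>p. subst_map N1 (\<lambda>z. \<alpha> (\<alpha> x) \<otimes> z \<otimes> \<alpha> y') (lp p x')) (br a y)"
definition "E4 a x y x' y' = subst_map N0 (\<lambda>p. subst_map N1 (\<lambda>z. \<alpha> (\<alpha> x) \<otimes> \<alpha> x' \<otimes> z) (br p y')) (br a y)"
definition "E5 a x y x' y' = subst_map N0 (\<lambda>p. subst_map N3 (\<lambda>z. z \<otimes> \<alpha> y' \<otimes> \<alpha> (\<alpha> y)) (lp p x')) (lp a x)"
definition "E6 a x y x' y' = subst_map N0 (\<lambda>p. subst_map N3 (\<lambda>z. \<alpha> x' \<otimes> z \<otimes> \<alpha> (\<alpha> y)) (br p y')) (lp a x)"
definition "E7 a x y x' y' = subst_map N0 (\<lambda>p. subst_map N3 (\<lambda>z. z \<otimes> \<alpha> y' \<otimes> \<alpha> p) (lp (\<alpha> x) x')) (br a y)"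
definition "E8 a x y x' y' = subst_map N0 (\<lambda>p. subst_map N3 (\<lambda>z. \<alpha> x' \<otimes> z \<otimes> \<alpha> p) (br (\<alpha> x) y')) (br a y)"

definition "M2 a x y x' y' = subst_map N0 (\<lambda>p. subst_map N3 (\<lambda>z. \<alpha> x' \<otimes> z \<otimes> \<alpha> (\<alpha> y)) (lp p y')) (lp a x)"
definition "M3 a x y x' y' = subst_map O3 (\<lambda>z. subst_map N0 (\<lambda>w. w \<otimes> \<alpha> (\<alpha> y') \<otimes> \<alpha> (\<alpha> y)) (lp (\<alpha> a) z)) (lp x x')"
definition "M4 a x y x' y' = subst_map O3 (\<lambda>z. subst_map N0 (\<lambda>w. \<alpha> z \<otimes> w \<otimes> \<alpha> (\<alpha> y)) (lp (\<alpha> a) (\<alpha> y'))) (lp x x')"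
definition "M5 a x y x' y' = subst_map O3 (\<lambda>z. subst_map N0 (\<lambda>w. w \<otimes> \<alpha> z \<otimes> \<alpha> (\<alpha> y)) (lp (\<alpha> a) (\<alpha> x'))) (lp x y')"
definition "M6 a x y x' y' = subst_map O3 (\<lambda>z. subst_map N0 (\<lambda>w. \<alpha> (\<alpha> x') \<otimes> w \<otimes> \<alpha> (\<alpha> y)) (lp (\<alpha> a) z)) (lp x y')"

definition "Z1 a x y x' y' = subst_map O1 (\<lambda>z. subst_map N0 (\<lambda>w. \<alpha> (\<alpha> x') \<otimes> w \<otimes> \<alpha> (\<alpha> y)) (lp (\<alpha> a) z)) (lp y' x)"
definition "Z2 a x y x' y' = subst_map N0 (\<lambda>p. subst_map O1 (\<lambda>w. \<alpha> (\<alpha> x') \<otimes> w \<otimes> \<alpha> (\<alpha> y)) (lp (\<alpha> y') p)) (lp a x)"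
definition "Z3 a x y x' y' = subst_map O1 (\<lambda>z. subst_map N0 (\<lambda>w. \<alpha> (\<alpha> x) \<otimes> \<alpha> (\<alpha> x') \<otimes> w) (br (\<alpha> a) z)) (br y y')"

lemmas term_defs = B1_def B3_def B5_def E1_def E2_def E3_def E4_def E5_def E6_def E7_def E8_def
  M2_def M3_def M4_def M5_def M6_def Z1_def Z2_def Z3_def

text \<open>With this, the substitution for the product with a moves outermost, where the
  coassociator terms have it.\<close>

lemma subst_map_commute:
  assumes "\<And>y. clinear (\<lambda>x. f x y)" "\<And>x. clinear (f x)"
  shows "subst_map O1 (\<lambda>x. subst_map N0 (\<lambda>y. f x y) q) p = subst_map N0 (\<lambda>y. subst_map O1 (\<lambda>x. f x y) p) q"
    "subst_map O3 (\<lambda>x. subst_map N0 (\<lambda>y. f x y) q) p = subst_map N0 (\<lambda>y. subst_map O3 (\<lambda>x. f x y) p) q"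
    "subst_map N1 (\<lambda>x. subst_map N0 (\<lambda>y. f x y) q) p = subst_map N0 (\<lambda>y. subst_map N1 (\<lambda>x. f x y) p) q"
    "subst_map N2 (\<lambda>x. subst_map N0 (\<lambda>y. f x y) q) p = subst_map N0 (\<lambda>y. subst_map N2 (\<lambda>x. f x y) p) q"
    "subst_map N3 (\<lambda>x. subst_map N0 (\<lambda>y. f x y) q) p = subst_map N0 (\<lambda>y. subst_map N3 (\<lambda>x. f x y) p) q"
  by (rule subst_map_swap; simp add: O_linear N_linear operator_simps cbilinear_def assms)+

lemmas alpha_simps = subst_map_lp_alpha subst_map_bracket_alpha

section \<open>The summands of [[r,r]] under the action of a\<close>

lemma Q1_B1: "Q1 a (B1 x y x' y') = M3 a (\<alpha> x) (\<alpha> y) (\<alpha> x') (\<alpha> y')"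
  by (simp add: term_defs Q_subst_map Q_tensor linear_simps alpha_simps)

lemma Q2_B1: "Q2 a (B1 x y x' y') = M4 a (\<alpha> x) (\<alpha> y) (\<alpha> x') (\<alpha> y')"
  by (simp add: term_defs Q_subst_map Q_tensor linear_simps alpha_simps)

text \<open>Here and below, the powers of \<alpha> on the arguments at the right are a surplus that
  invariance of r removes after summation.\<close>

lemma Q3_B1: "Q3 a (B1 x y x' y') = E7 a (\<alpha> x) (\<alpha> y) (\<alpha> (\<alpha> x')) (\<alpha> (\<alpha> y'))"
  by (simp add: term_defs Q_subst_map Q_tensor linear_simps alpha_simps subst_map_commute)

lemma Q1_B5: "Q1 a (B5 x y x' y') = E2 a (\<alpha> x) (\<alpha> y) (\<alpha> (\<alpha> x')) (\<alpha> (\<alpha> y'))"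
  by (simp add: term_defs Q_subst_map Q_tensor linear_simps alpha_simps subst_map_commute)

lemma Q3_B5: "Q3 a (B5 x y x' y') = Z3 a (\<alpha> x) (\<alpha> y) (\<alpha> x') (\<alpha> y')"
  by (simp add: term_defs Q_subst_map Q_tensor linear_simps alpha_simps)

text \<open>The bracket [l', r] splits: l' r gives a coassociator term with the copies of r
  exchanged, and r l' gives a term of M.\<close>

lemma Q1_B3: "Q1 a (B3 x y x' y') =
  E1 a (\<alpha> x') (\<alpha> y') (\<alpha> (\<alpha> x)) (\<alpha> (\<alpha> y)) - M5 a (\<alpha> x) (\<alpha> y) (\<alpha> x') (\<alpha> y')"
proof -
  let ?f = "\<lambda>z. subst_map N0 (\<lambda>w. \<alpha> w \<otimes> \<alpha> (\<alpha> z) \<otimes> \<alpha> (\<alpha> (\<alpha> y))) (lp a (\<alpha> x'))"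
  \<comment> \<open>The bracket lies in slot 2 and has variable \<open>N1\<close> after a acts on
    slot 1; the swapped variable is \<open>-N1 - O2 = O3\<close>.\<close>
  have "subst_map N1 ?f (br y' x) = subst_map N1 ?f (lp y' x) - subst_map O3 ?f (lp x y')"
    by (rule subst_map_bracket[where U = O2])
      (simp_all add: linear_simps subst_map_N0_O O_tensor alpha_D, simp_all add: operator_simps)
  then show ?thesis
    by (simp add: term_defs Q_subst_map Q_tensor linear_simps alpha_simps subst_map_commute)
qed

lemma Q2_B3: "Q2 a (B3 x y x' y') =
  Z1 a (\<alpha> x) (\<alpha> y) (\<alpha> x') (\<alpha> y') - M6 a (\<alpha> x) (\<alpha> y) (\<alpha> x') (\<alpha> y')"
proof -
  let ?f = "\<lambda>z. subst_map N0 (\<lambda>w. \<alpha> (\<alpha> (\<alpha> x')) \<otimes> \<alpha> w \<otimes> \<alpha> (\<alpha> (\<alpha> y))) (lp a z)"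
  \<comment> \<open>Now a acts on the slot of the bracket itself, so \<partial> on the bracket
    becomes \<open>O2 + N0\<close>, and the swapped variable is
    \<open>-O1 - O2 - N0 = O3\<close>.\<close>
  have f: "?f (D z) = O2 (?f z) + N0 (?f z)" for z
    by (rule subst_map_lp_D_right) (simp_all add: linear_simps O_tensor alpha_D operator_commute_N0)
  have "subst_map O1 ?f (br y' x) = subst_map O1 ?f (lp y' x) - subst_map O3 ?f (lp x y')"
    by (rule subst_map_bracket[where U = "\<lambda>t. O2 t + N0 t"])
      (simp_all add: linear_simps f, simp_all add: operator_simps)
  then show ?thesis
    by (simp add: term_defs Q_subst_map Q_tensor linear_simps alpha_simps)
qed

text \<open>The rearranged axiom [a,l'] r = a (l' r) - l' (a r) in slot 2. The first term also
  arises when a acts on the bracket in [[r,r]]; the second will cancel against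
  \<open>E6\<close>.\<close>

lemma E3_eq: "E3 a x' y' (\<alpha> x) (\<alpha> y) = Z1 a x y x' y' - Z2 a x y x' y'"
proof -
  let ?g = "\<lambda>z. \<alpha> (\<alpha> x') \<otimes> z \<otimes> \<alpha> (\<alpha> y)"
  let ?f = "\<lambda>p. subst_map N1 ?g (lp p (\<alpha> x))"
  have "subst_map N0 ?f (br a y') = subst_map N0 ?f (lp a y') - subst_map O1 ?f (lp y' a)"
    by (rule subst_map_bracket[where U = "\<lambda>t. - N1 t"])
      (simp_all add: linear_simps subst_map_lp_D_left, simp_all add: operator_simps)
  moreover have "subst_map N0 ?f (lp a y') - subst_map O1 (\<lambda>z. subst_map N0 ?g (lp (\<alpha> a) z)) (lp y' x) =
      subst_map O1 ?f (lp y' a) - subst_map N0 (\<lambda>z. subst_map O1 ?g (lp (\<alpha> y') z)) (lp a x)"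
    by (rule left_symmetric_subst) (simp_all add: linear_simps, simp_all add: operator_simps)
  then have "subst_map N0 ?f (lp a y') = subst_map O1 ?f (lp y' a) + (Z1 a x y x' y' - Z2 a x y x' y')"
    by (simp add: term_defs diff_eq_eq)
  ultimately show ?thesis
    by (simp add: E3_def)
qed

text \<open>The bracket [a r, l'] splits: (a r) l' belongs to M, and l' (a r) is the term left over
  from left symmetry.\<close>

lemma E6_eq: "E6 a x y (\<alpha> x') (\<alpha> y') = M2 a x y (\<alpha> x') (\<alpha> y') - Z2 a x y x' y'"
proof -
  let ?g = "\<lambda>z. \<alpha> (\<alpha> x') \<otimes> z \<otimes> \<alpha> (\<alpha> y)"
  have "subst_map N3 ?g (br p (\<alpha> y')) = subst_map N3 ?g (lp p (\<alpha> y')) - subst_map O1 ?g (lp (\<alpha> y') p)" for p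
    by (rule subst_map_bracket[where U = O2])
      (simp_all add: linear_simps O_tensor, simp_all add: operator_simps)
  then show ?thesis
    by (simp add: term_defs subst_map_diff_fun linear_simps)
qed

text \<open>[[r,r]] has [l', r] at \<open>O1\<close>, the coassociator has [r, l'] at
  \<open>N3 = -O1 - O2\<close>; skew symmetry supplies the sign.\<close>

lemma Q3_B3: "Q3 a (B3 x y x' y') = - E8 a (\<alpha> x) (\<alpha> y) (\<alpha> (\<alpha> x')) (\<alpha> (\<alpha> y'))"
proof -
  have "subst_map N3 (\<lambda>z. \<alpha> (\<alpha> (\<alpha> x')) \<otimes> z \<otimes> \<alpha> p) (br (\<alpha> (\<alpha> x)) (\<alpha> (\<alpha> y'))) =
      - subst_map O1 (\<lambda>z. \<alpha> (\<alpha> (\<alpha> x')) \<otimes> z \<otimes> \<alpha> p) (br (\<alpha> (\<alpha> y')) (\<alpha> (\<alpha> x)))" for p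
    by (rule subst_map_bracket_skew[where U = O2])
      (simp_all add: linear_simps O_tensor, simp_all add: operator_simps)
  then show ?thesis
    by (simp add: term_defs Q_subst_map Q_tensor linear_simps alpha_simps subst_map_commute subst_map_minus_fun)
qed

lemma tau12_O: "tau12 (O1 t) = O2 (tau12 t)" "tau12 (O2 t) = O1 (tau12 t)" "tau12 (O3 t) = O3 (tau12 t)"
  by (rule tensor3_eqI[where t = t]; simp add: linear_simps O_tensor tau12_tensor)+

lemma tau12_N: "tau12 (N0 t) = N0 (tau12 t)" "tau12 (N1 t) = N2 (tau12 t)" "tau12 (N2 t) = N1 (tau12 t)"
   "tau12 (N3 t) = N3 (tau12 t)"
  by (simp_all add: N0_def D_tensor3_def N1_def N2_def N3_def tau12_O clinear_add[OF tau12_linear]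
      clinear_diff[OF tau12_linear] clinear_minus[OF tau12_linear])

lemma tau12_subst_map:
  assumes "clinear f"
  shows "tau12 (subst_map O1 f p) = subst_map O2 (\<lambda>x. tau12 (f x)) p"
    "tau12 (subst_map O2 f p) = subst_map O1 (\<lambda>x. tau12 (f x)) p"
    "tau12 (subst_map O3 f p) = subst_map O3 (\<lambda>x. tau12 (f x)) p"
    "tau12 (subst_map N0 f p) = subst_map N0 (\<lambda>x. tau12 (f x)) p"
    "tau12 (subst_map N1 f p) = subst_map N2 (\<lambda>x. tau12 (f x)) p"
    "tau12 (subst_map N3 f p) = subst_map N3 (\<lambda>x. tau12 (f x)) p"
  by (intro subst_map_intertwine tau12_linear O_linear N_linear tau12_O tau12_N assms)+

text \<open>Acting on slot 2 instead of slot 1 mirrors the term under \<tau>12 and exchange of the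
  copies of r. The sign is the skew symmetry of [l, l'], whose variable goes from \<open>O1\<close>
  to \<open>N2 = -O1 - O3\<close>.\<close>

lemma Q2_B5: "Q2 a (B5 x y x' y') = - tau12 (E2 a (\<alpha> x') (\<alpha> y') (\<alpha> (\<alpha> x)) (\<alpha> (\<alpha> y)))"
proof -
  have "subst_map N2 (\<lambda>z. \<alpha> (\<alpha> (\<alpha> x)) \<otimes> \<alpha> p \<otimes> z) (br (\<alpha> (\<alpha> y')) (\<alpha> (\<alpha> y))) =
      - subst_map O1 (\<lambda>z. \<alpha> (\<alpha> (\<alpha> x)) \<otimes> \<alpha> p \<otimes> z) (br (\<alpha> (\<alpha> y)) (\<alpha> (\<alpha> y')))" for p
    by (rule subst_map_bracket_skew[where U = O3])
      (simp_all add: linear_simps O_tensor, simp_all add: operator_simps)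
  then show ?thesis
    by (simp add: term_defs Q_subst_map Q_tensor linear_simps alpha_simps subst_map_commute subst_map_minus_fun
        tau12_subst_map tau12_tensor)
qed

text \<open>Hom-Jacobi for [a, [l, l']] in slot 3: [[a, l], l'] is a coassociator term, and
  [[a, l'], l] is its mirror image under exchange of the copies of r and of slots 1 and 2.\<close>

lemma Z3_eq: "Z3 a x y x' y' = E4 a x y (\<alpha> x') (\<alpha> y') - tau12 (E4 a x' y' (\<alpha> x) (\<alpha> y))"
proof -
  let ?g = "\<lambda>z. \<alpha> (\<alpha> x) \<otimes> \<alpha> (\<alpha> x') \<otimes> z"
  have "subst_map O1 (\<lambda>z. subst_map N0 ?g (br (\<alpha> a) z)) (br y y') =
      subst_map N0 (\<lambda>z. subst_map N1 ?g (br z (\<alpha> y'))) (br a y)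
      - subst_map N0 (\<lambda>z. subst_map N2 ?g (br z (\<alpha> y))) (br a y')"
    by (rule bracket_jacobi_subst[where U = O3])
      (simp_all add: linear_simps O_tensor, simp_all add: operator_simps)
  then show ?thesis
    by (simp add: term_defs linear_simps tau12_subst_map tau12_tensor)
qed

text \<open>Their sum therefore commutes with \<tau>12, and only one of each mirror pair in [[r,r]]
  has to be computed.\<close>

lemma Q_tau12: "Q1 a (tau12 t) = tau12 (Q2 a t)" "Q2 a (tau12 t) = tau12 (Q1 a t)"
  "Q3 a (tau12 t) = tau12 (Q3 a t)"
  by (rule tensor3_eqI[where t = t];
     simp add: clinear_compose[OF Q_linear(1)] clinear_compose[OF Q_linear(2)] clinear_compose[OF Q_linear(3)]
       Q_linear linear_simps Q_tensor tau12_tensor tau12_subst_map)+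

end

section \<open>The obstruction as an antisymmetrised coassociator\<close>

lemma subst_map_sum_fun:
  "clinear T \<Longrightarrow> (\<And>j. clinear (f j)) \<Longrightarrow>
    subst_map T (\<lambda>x. \<Sum>j\<in>J. f j x) p = (\<Sum>j\<in>J. subst_map T (f j) p)"
  by (simp add: subst_map_bound[OF _ _ order_refl] clinear_sum_fun clinear_sum[OF clinear_funpow]
      sum.swap[of _ J])

text \<open>The four linearities are grouped by copies of r, so that invariance can be applied to
  one copy at a time.\<close>

definition quadrilinear ::
  "('a::complex_vector \<Rightarrow> 'a \<Rightarrow> 'a \<Rightarrow> 'a \<Rightarrow> 'b::complex_vector) \<Rightarrow> bool" where
  "quadrilinear G \<longleftrightarrow> (\<forall>x' y'. cbilinear (\<lambda>x y. G x y x' y')) \<and> (\<forall>x y. cbilinear (G x y))"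

context hom_left_symmetric_conformal_algebra
begin

lemma quadrilinear_terms:
  "quadrilinear (E1 a)" "quadrilinear (E2 a)" "quadrilinear (E3 a)" "quadrilinear (E4 a)"
  "quadrilinear (E6 a)" "quadrilinear (E7 a)" "quadrilinear (E8 a)"
  "quadrilinear (M2 a)" "quadrilinear (M3 a)" "quadrilinear (M4 a)" "quadrilinear (M5 a)" "quadrilinear (M6 a)"
  "quadrilinear (Z1 a)" "quadrilinear (Z3 a)"
  by (simp_all add: quadrilinear_def cbilinear_def term_defs[abs_def] linear_simps)

lemma quadrilinear_alpha: "quadrilinear G \<Longrightarrow> quadrilinear (\<lambda>x y x' y'. G x y (\<alpha> x') (\<alpha> y'))"
  using linear_alpha unfolding quadrilinear_def
  by (auto intro!: cbilinearI intro: cbilinear_left cbilinear_right simp: cbilinear_def)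

lemma N0_eta: "(\<lambda>t. - D_tensor3 D t) = N0"
  by (simp add: N0_def fun_eq_iff)

lemma Q_part_eq:
  "tensor_map (tensor_map \<alpha> \<alpha>) \<alpha> (subst_op (\<lambda>t. - D_tensor3 D t) (Q_op D \<alpha> lp a t)) = Q1 a t + Q2 a t + Q3 a t"
  unfolding N0_eta Q_op_def Q1_def Q2_def Q3_def
  by (simp add: clinear_add[OF subst_op_linear[OF N_linear(1)]] clinear_add[OF alpha3_linear])

lemma P_op_linear: "clinear (P_op \<alpha> lp x)"
  unfolding P_op_def[abs_def]
  by (intro clinear_plus poly_tensor_linear tensor_poly_linear lp_linear linear_alpha)

lemma P_op_tensor:
  "P_op \<alpha> lp x (y \<otimes> z) = map_poly (\<lambda>w. w \<otimes> \<alpha> z) (lp x y) + map_poly (\<lambda>w. \<alpha> y \<otimes> w) (lp x z)"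
  by (simp add: P_op_def poly_tensor_tensor tensor_poly_tensor lp_linear linear_alpha)

text \<open>The two summands of P(x) are mirror images under the flip; this turns the r_21 in M into
  an application of \<tau>12.\<close>

lemma P_op_swap: "P_op \<alpha> lp x (tensor_swap t) = map_poly tensor_swap (P_op \<alpha> lp x t)"
  by (rule tensor_eqI[where t = t])
    (simp_all add: clinear_compose[OF P_op_linear] clinear_compose[OF clinear_map_poly] tensor_swap_linear
      P_op_linear tensor_swap_tensor P_op_tensor clinear_add[OF clinear_map_poly] map_poly_map_poly
      clinear_0 comp_def tensor_0_left tensor_0_right add.commute)

lemma P_op_linear_param: "clinear (\<lambda>x. P_op \<alpha> lp x t)"
proof -
  have "clinear (\<lambda>x. map_poly (\<lambda>w. w \<otimes> \<alpha> z) (lp x y))"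
    "clinear (\<lambda>x. map_poly (\<lambda>w. \<alpha> z \<otimes> w) (lp x y))" for y z
    by (intro clinear_compose[OF clinear_map_poly] lp_linear_left clinear_ident
        clinear_tensor_left clinear_tensor_right)+
  then show ?thesis
    unfolding P_op_def poly_tensor_def tensor_poly_def
    by (intro clinear_plus tensor_lift_linear_param poly_tensor_bilinear tensor_poly_bilinear
        lp_linear linear_alpha)
qed

lemma subst_map_P_op_linear:
  "clinear T \<Longrightarrow> clinear f \<Longrightarrow> clinear (\<lambda>t. subst_map T f (P_op \<alpha> lp z t))"
  "clinear T \<Longrightarrow> clinear f \<Longrightarrow> clinear (\<lambda>z. subst_map T f (P_op \<alpha> lp z t))"
  by (blast intro: clinear_compose[OF subst_map_linear P_op_linear]
      clinear_compose[OF subst_map_linear P_op_linear_param])+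

lemma N3_eta: "(\<lambda>t. - tensor_map (D_tensor2 D) id t) = N3"
proof
  fix t :: "'a \<otimes> 'a \<otimes> 'a"
  show "- tensor_map (D_tensor2 D) id t = N3 t"
  proof (rule tensor3_eqI[where t = t])
    show "clinear (\<lambda>t. - tensor_map (D_tensor2 D) id (t :: 'a \<otimes> 'a \<otimes> 'a))"
      by (intro clinear_uminus tensor_map_linear D_tensor2_linear linear_D clinear_id)
    show "- tensor_map (D_tensor2 D) id (x \<otimes> y \<otimes> z) = N3 (x \<otimes> y \<otimes> z)" for x y z :: 'a
      by (simp add: tensor_map_tensor[OF D_tensor2_linear[OF linear_D] clinear_id]
          D_tensor2_tensor[OF linear_D] N3_def O_tensor tensor_add_left)
  qed (rule N_linear)
qed

lemma swap_tensor: "tensor_swap t \<otimes> z = tau12 (t \<otimes> z)"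
  by (simp add: tau12_def tensor_map_tensor tensor_swap_linear clinear_id)

lemma D_tensor3_linear: "clinear (D_tensor3 D)"
  unfolding D_tensor3_def[abs_def] by (intro clinear_plus O_linear)

lemma tensor_assoc_D:
  "tensor_assoc (x \<otimes> D_tensor2 D s) = O2 (tensor_assoc (x \<otimes> s)) + O3 (tensor_assoc (x \<otimes> s))"
  "tensor_assoc (D x \<otimes> s) = O1 (tensor_assoc (x \<otimes> s))"
  by (rule tensor_eqI[where t = s];
     simp add: clinear_compose[OF tensor_assoc_linear] linear_simps D_tensor2_linear[OF linear_D]
       D_tensor2_tensor[OF linear_D] tensor_add_right clinear_add[OF tensor_assoc_linear] tensor_assoc_tensor O_tensor)+

lemma tensor_D_left:
  "D_tensor2 D s \<otimes> z = O1 (s \<otimes> z) + O2 (s \<otimes> z)" "s \<otimes> D z = O3 (s \<otimes> z)"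
  by (rule tensor_eqI[where t = s];
     simp add: linear_simps D_tensor2_linear[OF linear_D] D_tensor2_tensor[OF linear_D] tensor_add_left O_tensor)+

lemma assoc_tensor_linear: "clinear (\<lambda>s. tensor_assoc (x \<otimes> s))"
  by (intro clinear_compose[OF tensor_assoc_linear] clinear_tensor_right clinear_ident)

end

section \<open>Double sums over an invariant r\<close>

locale invariant_tensor = hom_left_symmetric_conformal_algebra D \<alpha> lp
  for D \<alpha> :: "'a::complex_vector \<Rightarrow> 'a" and lp +
  fixes I :: "'i set" and u v :: "'i \<Rightarrow> 'a"
  assumes invariant: "tensor_map \<alpha> \<alpha> (\<Sum>i\<in>I. u i \<otimes> v i) = (\<Sum>i\<in>I. u i \<otimes> v i)"
begin

definition dsum :: "('a \<Rightarrow> 'a \<Rightarrow> 'a \<Rightarrow> 'a \<Rightarrow> 'a \<otimes> 'a \<otimes> 'a) \<Rightarrow> 'a \<otimes> 'a \<otimes> 'a" where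
  "dsum G = (\<Sum>i\<in>I. \<Sum>j\<in>I. G (u i) (v i) (u j) (v j))"

text \<open>A bilinear map factors through the tensor product, so the sum depends only on r, which
  \<alpha> \<otimes> \<alpha> fixes even if the chosen representatives change.\<close>

lemma sum_alpha:
  assumes "cbilinear F"
  shows "(\<Sum>i\<in>I. F (\<alpha> (u i)) (\<alpha> (v i))) = (\<Sum>i\<in>I. F (u i) (v i))"
  using arg_cong[OF invariant, of "tensor_lift F"] assms linear_alpha
  by (simp add: clinear_sum[OF tensor_map_linear] clinear_sum[OF tensor_lift_linear] tensor_map_tensor
      tensor_lift_tensor)

lemma dsum_alpha_right:
  "quadrilinear G \<Longrightarrow> dsum (\<lambda>x y x' y'. G x y (\<alpha> x') (\<alpha> y')) = dsum G"
  unfolding dsum_def quadrilinear_def by (simp add: sum_alpha)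

lemma dsum_alpha_left:
  assumes "quadrilinear G"
  shows "dsum (\<lambda>x y x' y'. G (\<alpha> x) (\<alpha> y) x' y') = dsum G"
  unfolding dsum_def using assms
  by (intro sum_alpha[where F = "\<lambda>x y. \<Sum>j\<in>I. G x y (u j) (v j)"])
    (simp add: quadrilinear_def cbilinear_def clinear_sum_fun)

lemma dsum_alpha:
  "quadrilinear G \<Longrightarrow> dsum (\<lambda>x y x' y'. G (\<alpha> x) (\<alpha> y) (\<alpha> x') (\<alpha> y')) = dsum G"
  "quadrilinear G \<Longrightarrow> dsum (\<lambda>x y x' y'. G (\<alpha> x) (\<alpha> y) (\<alpha> (\<alpha> x')) (\<alpha> (\<alpha> y'))) = dsum G"
  by (simp_all add: dsum_alpha_left[OF quadrilinear_alpha] dsum_alpha_right quadrilinear_alpha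
      dsum_alpha_left[OF quadrilinear_alpha[OF quadrilinear_alpha]]
      dsum_alpha_right[OF quadrilinear_alpha])

lemma dsum_swap: "dsum (\<lambda>x y x' y'. G x' y' x y) = dsum G"
  unfolding dsum_def by (rule sum.swap)

lemma dsum_diff: "dsum (\<lambda>x y x' y'. G x y x' y' - H x y x' y') = dsum G - dsum H"
  by (simp add: dsum_def sum_subtractf)

lemma dsum_minus: "dsum (\<lambda>x y x' y'. - G x y x' y') = - dsum G"
  by (simp add: dsum_def sum_negf)

lemma dsum_linear: "clinear h \<Longrightarrow> h (dsum G) = dsum (\<lambda>x y x' y'. h (G x y x' y'))"
  by (simp add: dsum_def clinear_sum)

lemma dsum_Q:
  "Q1 a (dsum B1) = dsum (M3 a)" "Q2 a (dsum B1) = dsum (M4 a)" "Q3 a (dsum B1) = dsum (E7 a)"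
  "Q1 a (dsum B3) = dsum (E1 a) - dsum (M5 a)" "Q2 a (dsum B3) = dsum (Z1 a) - dsum (M6 a)"
  "Q3 a (dsum B3) = - dsum (E8 a)" "Q1 a (dsum B5) = dsum (E2 a)" "Q2 a (dsum B5) = - tau12 (dsum (E2 a))"
  "Q3 a (dsum B5) = dsum (Z3 a)"
proof -
  have *: "dsum (\<lambda>x y x' y'. G (\<alpha> x') (\<alpha> y') (\<alpha> (\<alpha> x)) (\<alpha> (\<alpha> y))) = dsum G" if "quadrilinear G" for G
    using dsum_alpha(2)[OF that] dsum_swap[of "\<lambda>x y x' y'. G (\<alpha> x) (\<alpha> y) (\<alpha> (\<alpha> x')) (\<alpha> (\<alpha> y'))"] by simp
  have "dsum (\<lambda>x y x' y'. tau12 (E2 a (\<alpha> x') (\<alpha> y') (\<alpha> (\<alpha> x)) (\<alpha> (\<alpha> y)))) = tau12 (dsum (E2 a))"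
    unfolding *[OF quadrilinear_terms(2), of a, symmetric] by (simp add: dsum_linear[OF tau12_linear])
  then show "Q2 a (dsum B5) = - tau12 (dsum (E2 a))"
    by (simp add: dsum_linear[OF Q_linear(2)] Q2_B5 dsum_minus)
qed (simp_all add: dsum_linear[OF Q_linear(1)] dsum_linear[OF Q_linear(2)] dsum_linear[OF Q_linear(3)]
  Q1_B1 Q2_B1 Q3_B1 Q1_B3 Q2_B3 Q3_B3 Q1_B5 Q3_B5 dsum_alpha dsum_diff dsum_minus quadrilinear_terms
  dsum_swap[of "\<lambda>x y x' y'. E1 a (\<alpha> x) (\<alpha> y) (\<alpha> (\<alpha> x')) (\<alpha> (\<alpha> y'))"])

lemma dsum_E3: "dsum (E3 a) = dsum (Z1 a) - dsum (Z2 a)"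
proof -
  have "dsum (E3 a) = dsum (\<lambda>x y x' y'. E3 a x y (\<alpha> x') (\<alpha> y'))"
    by (simp add: dsum_alpha_right quadrilinear_terms)
  also have "\<dots> = dsum (\<lambda>x y x' y'. E3 a x' y' (\<alpha> x) (\<alpha> y))"
    by (rule dsum_swap[symmetric])
  finally show ?thesis
    by (simp add: E3_eq dsum_diff)
qed

lemma dsum_E6: "dsum (E6 a) = dsum (M2 a) - dsum (Z2 a)"
proof -
  have "dsum (E6 a) = dsum (\<lambda>x y x' y'. E6 a x y (\<alpha> x') (\<alpha> y'))"
    by (simp add: dsum_alpha_right quadrilinear_terms)
  also have "\<dots> = dsum (M2 a) - dsum (Z2 a)"
    by (simp add: E6_eq dsum_diff dsum_alpha_right quadrilinear_terms)
  finally show ?thesis .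
qed

lemma dsum_Z3: "dsum (Z3 a) = dsum (E4 a) - tau12 (dsum (E4 a))"
proof -
  have "dsum (\<lambda>x y x' y'. tau12 (E4 a x' y' (\<alpha> x) (\<alpha> y))) = dsum (\<lambda>x y x' y'. tau12 (E4 a x y (\<alpha> x') (\<alpha> y')))"
    by (rule dsum_swap)
  also have "\<dots> = tau12 (dsum (E4 a))"
    by (simp add: dsum_linear[OF tau12_linear, symmetric] dsum_alpha_right quadrilinear_terms)
  moreover have "dsum (Z3 a) = dsum (\<lambda>x y x' y'. E4 a x y (\<alpha> x') (\<alpha> y'))
      - dsum (\<lambda>x y x' y'. tau12 (E4 a x' y' (\<alpha> x) (\<alpha> y)))"
    unfolding Z3_eq[abs_def] by (rule dsum_diff)
  ultimately show ?thesis
    by (simp add: dsum_alpha_right quadrilinear_terms)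
qed

text \<open>Under \<tau>12 the first sum of [[r,r]] is mirrored by the second and the third by the
  fourth, where the variable moves from slot 1 to slot 2. The first four sums thus form an
  antisymmetrisation.\<close>

lemma rr_bracket_eq:
  "rr_bracket D \<alpha> lp I u v = dsum B1 - tau12 (dsum B1) - dsum B3 + tau12 (dsum B3) - dsum B5"
  unfolding rr_bracket_def dsum_linear[OF tau12_linear] subst_map_def[symmetric]
  by (simp add: dsum_def term_defs tau12_subst_map linear_simps tau12_tensor)

section \<open>The term M as an antisymmetrisation\<close>

abbreviation "r \<equiv> \<Sum>i\<in>I. u i \<otimes> v i"

text \<open>M with an arbitrary tensor in place of \<open>r_12 - r_21\<close>, so that linearity
  separates the two contributions.\<close>

definition M_half :: "'a \<Rightarrow> 'a \<otimes> 'a \<Rightarrow> 'a \<otimes> 'a \<otimes> 'a" where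
  "M_half a t = (\<Sum>i\<in>I. subst_map N0 (\<lambda>z. subst_map N3 (\<lambda>w. w \<otimes> \<alpha> (\<alpha> (v i))) (P_op \<alpha> lp z t)) (lp a (u i)))
    - (\<Sum>i\<in>I. subst_map O3 (\<lambda>w. subst_map N0 (\<lambda>w'. w' \<otimes> \<alpha> (\<alpha> (v i))) (P_op \<alpha> lp (\<alpha> a) w)) (P_op \<alpha> lp (u i) t))"

lemma M_half_linear: "clinear (M_half a)"
  unfolding M_half_def[abs_def]
  by (intro clinear_minus_fun clinear_sum_fun subst_map_linear_param subst_map_P_op_linear N_linear O_linear
      clinear_tensor_left clinear_ident)

lemma M_half_swap: "M_half a (tensor_swap t) = tau12 (M_half a t)"
  unfolding M_half_def
  by (simp add: P_op_swap subst_map_compose linear_simps tensor_swap_linear subst_map_P_op_linear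
      swap_tensor clinear_diff[OF tau12_linear] clinear_sum[OF tau12_linear] tau12_subst_map)

lemma M_term_eq: "M_term D \<alpha> lp I u v a = M_half a r - tau12 (M_half a r)"
proof -
  have "(\<Sum>i\<in>I. v i \<otimes> u i) = tensor_swap r"
    by (simp add: clinear_sum[OF tensor_swap_linear] tensor_swap_tensor)
  then have "M_term D \<alpha> lp I u v a = M_half a (r - tensor_swap r)"
    unfolding M_term_def Let_def N0_eta N3_eta M_half_def subst_map_def by simp
  then show ?thesis
    by (simp add: clinear_diff[OF M_half_linear] M_half_swap)
qed

text \<open>P(a r) contributes one term for each of slots 1 and 2; the composite of P(a) and P(r)
  contributes one for each of the four choices of two slots.\<close>

lemma M_half_eq: "M_half a r = dsum (E5 a) + dsum (M2 a) - dsum (M3 a) - dsum (M4 a) - dsum (M5 a) - dsum (M6 a)"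
proof -
  have 1: "subst_map T f (P_op \<alpha> lp x r) = (\<Sum>j\<in>I. subst_map T (\<lambda>w. f (w \<otimes> \<alpha> (v j))) (lp x (u j))
      + subst_map T (\<lambda>w. f (\<alpha> (u j) \<otimes> w)) (lp x (v j)))"
    if "clinear T" "clinear f" for T :: "'a \<otimes> 'a \<otimes> 'a \<Rightarrow> 'a \<otimes> 'a \<otimes> 'a" and f x
    using that by (simp add: clinear_sum[OF P_op_linear] clinear_sum[OF subst_map_linear] P_op_tensor
        clinear_add[OF subst_map_linear] subst_map_compose linear_simps)
  have 2: "subst_map N0 (\<lambda>z. subst_map N3 (\<lambda>w. w \<otimes> \<alpha> (\<alpha> y)) (P_op \<alpha> lp z r)) (lp a x) =
     (\<Sum>j\<in>I. E5 a x y (u j) (v j) + M2 a x y (u j) (v j))" for x y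
    by (simp add: 1 linear_simps subst_map_sum_fun subst_map_add_fun term_defs)
  have 3: "subst_map N0 (\<lambda>w'. w' \<otimes> \<alpha> (\<alpha> y)) (P_op \<alpha> lp z (p \<otimes> q)) =
    subst_map N0 (\<lambda>w. w \<otimes> \<alpha> q \<otimes> \<alpha> (\<alpha> y)) (lp z p) + subst_map N0 (\<lambda>w. \<alpha> p \<otimes> w \<otimes> \<alpha> (\<alpha> y)) (lp z q)" for y z p q
    by (simp add: P_op_tensor clinear_add[OF subst_map_linear] subst_map_compose linear_simps)
  have 4: "subst_map O3 (\<lambda>w. subst_map N0 (\<lambda>w'. w' \<otimes> \<alpha> (\<alpha> y)) (P_op \<alpha> lp (\<alpha> a) w)) (P_op \<alpha> lp x r) =
    (\<Sum>j\<in>I. (M3 a x y (u j) (v j) + M4 a x y (u j) (v j)) + (M5 a x y (u j) (v j) + M6 a x y (u j) (v j)))" for x y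
    by (simp add: 1 3 subst_map_P_op_linear linear_simps subst_map_add_fun term_defs)
  show ?thesis
    unfolding M_half_def 2 4 by (simp add: dsum_def sum.distrib)
qed

section \<open>The two iterated coproducts\<close>

abbreviation "\<delta> \<equiv> coboundary D \<alpha> lp r"
abbreviation "N \<equiv> (\<lambda>t. - D_tensor2 D t)"

lemma N_tensor2_linear: "clinear N"
  by (intro clinear_uminus D_tensor2_linear linear_D)

lemma coboundary_eq: "\<delta> a = (\<Sum>j\<in>I. subst_map N (\<lambda>z. z \<otimes> \<alpha> (v j)) (lp a (u j))
    + subst_map N (\<lambda>z. \<alpha> (u j) \<otimes> z) (br a (v j)))"
  unfolding coboundary_def
  by (simp add: clinear_sum[OF poly_tensor_linear] clinear_sum[OF tensor_poly_linear] lp_linear br_linear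
      linear_alpha poly_tensor_tensor tensor_poly_tensor clinear_add[OF subst_op_linear[OF N_tensor2_linear]]
      clinear_sum[OF subst_op_linear[OF N_tensor2_linear]] subst_map_def sum.distrib)

lemma coboundary_linear: "clinear \<delta>"
  unfolding coboundary_eq[abs_def]
  by (simp add: clinear_sum_fun linear_simps N_tensor2_linear)

text \<open>Product and bracket both turn \<partial> on a into minus the variable, which in \<delta>
  is minus the total \<partial>.\<close>

lemma coboundary_D: "\<delta> (D a) = D_tensor2 D (\<delta> a)"
  by (simp add: coboundary_eq clinear_sum[OF D_tensor2_linear[OF linear_D]] clinear_add[OF D_tensor2_linear[OF linear_D]]
      subst_map_lp_D_left subst_map_bracket_D_left N_tensor2_linear linear_simps)

lemma coassoc_right_linear: "clinear (\<lambda>t. tensor_assoc (tensor_map \<alpha> \<delta> t))"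
  by (intro clinear_compose[OF tensor_assoc_linear] tensor_map_linear coboundary_linear linear_alpha)

lemma coassoc_left_linear: "clinear (tensor_map \<delta> \<alpha>)"
  by (intro tensor_map_linear coboundary_linear linear_alpha)

text \<open>Since \<delta> is a \<partial>-module map, \<partial> on two slots becomes \<partial> on
  three; hence the outer variable of the iterated coproduct is \<open>N0\<close>.\<close>

lemma coassoc_right_D:
  "tensor_assoc (tensor_map \<alpha> \<delta> (D_tensor2 D t)) = D_tensor3 D (tensor_assoc (tensor_map \<alpha> \<delta> t))"
proof (rule tensor_eqI[where t = t])
  show "clinear (\<lambda>t. tensor_assoc (tensor_map \<alpha> \<delta> (D_tensor2 D t)))"
    by (rule clinear_compose[OF coassoc_right_linear D_tensor2_linear[OF linear_D]])
  show "clinear (\<lambda>t. D_tensor3 D (tensor_assoc (tensor_map \<alpha> \<delta> t)))"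
    by (rule clinear_compose[OF D_tensor3_linear coassoc_right_linear])
qed (simp add: clinear_add[OF coassoc_right_linear] D_tensor2_tensor[OF linear_D] tensor_map_tensor
    linear_alpha coboundary_linear coboundary_D alpha_D tensor_assoc_D D_tensor3_def)

lemma coassoc_right_N: "tensor_assoc (tensor_map \<alpha> \<delta> (N t)) = N0 (tensor_assoc (tensor_map \<alpha> \<delta> t))"
  by (simp add: clinear_minus[OF coassoc_right_linear] coassoc_right_D N0_def)

lemma coassoc_left_D: "tensor_map \<delta> \<alpha> (D_tensor2 D t) = D_tensor3 D (tensor_map \<delta> \<alpha> t)"
proof (rule tensor_eqI[where t = t])
  show "clinear (\<lambda>t. tensor_map \<delta> \<alpha> (D_tensor2 D t))"
    by (rule clinear_compose[OF coassoc_left_linear D_tensor2_linear[OF linear_D]])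
  show "clinear (\<lambda>t. D_tensor3 D (tensor_map \<delta> \<alpha> t))"
    by (rule clinear_compose[OF D_tensor3_linear coassoc_left_linear])
qed (simp add: clinear_add[OF coassoc_left_linear] D_tensor2_tensor[OF linear_D] tensor_map_tensor
    linear_alpha coboundary_linear coboundary_D alpha_D tensor_D_left D_tensor3_def)

lemma coassoc_left_N: "tensor_map \<delta> \<alpha> (N t) = N0 (tensor_map \<delta> \<alpha> t)"
  by (simp add: clinear_minus[OF coassoc_left_linear] coassoc_left_D N0_def)

text \<open>The inner \<delta> occupies slots 2 and 3, and minus the total \<partial> of these slots
  is \<open>N1\<close>.\<close>

lemma coassoc_right_tensor:
  "tensor_assoc (tensor_map \<alpha> \<delta> (x \<otimes> y)) = (\<Sum>j\<in>I. subst_map N1 (\<lambda>z. \<alpha> x \<otimes> z \<otimes> \<alpha> (v j)) (lp y (u j))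
    + subst_map N1 (\<lambda>z. \<alpha> x \<otimes> \<alpha> (u j) \<otimes> z) (br y (v j)))"
proof -
  have "tensor_assoc (x \<otimes> subst_map N f p) = subst_map N1 (\<lambda>z. tensor_assoc (x \<otimes> f z)) p"
    if "clinear f" for x f and p :: "'a poly"
    using that by (intro subst_map_intertwine[where h = "\<lambda>s. tensor_assoc (x \<otimes> s)"])
      (simp_all add: N_tensor2_linear linear_simps assoc_tensor_linear N1_def tensor_assoc_D
        clinear_minus[OF assoc_tensor_linear])
  then show ?thesis
    by (simp add: tensor_map_tensor linear_alpha coboundary_linear coboundary_eq linear_simps
        clinear_sum[OF assoc_tensor_linear] clinear_add[OF assoc_tensor_linear] tensor_assoc_tensor)
qed

lemma coassoc_left_tensor:
  "tensor_map \<delta> \<alpha> (x \<otimes> y) = (\<Sum>j\<in>I. subst_map N3 (\<lambda>z. z \<otimes> \<alpha> (v j) \<otimes> \<alpha> y) (lp x (u j))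
    + subst_map N3 (\<lambda>z. \<alpha> (u j) \<otimes> z \<otimes> \<alpha> y) (br x (v j)))"
proof -
  note lin = clinear_tensor_left[OF clinear_ident]
  have "subst_map N f p \<otimes> y = subst_map N3 (\<lambda>z. f z \<otimes> y) p"
    if "clinear f" for y f and p :: "'a poly"
    using that by (intro subst_map_intertwine[where h = "\<lambda>s. s \<otimes> y"])
      (simp_all add: N_tensor2_linear linear_simps N3_def tensor_D_left clinear_minus[OF lin])
  then show ?thesis
    by (simp add: tensor_map_tensor linear_alpha coboundary_linear coboundary_eq linear_simps
        clinear_sum[OF lin] clinear_add[OF lin])
qed

lemma coassoc_right_eq:
  "tensor_assoc (tensor_map \<alpha> \<delta> (\<delta> a)) = dsum (E1 a) + dsum (E2 a) + dsum (E3 a) + dsum (E4 a)"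
proof -
  have "tensor_assoc (tensor_map \<alpha> \<delta> (subst_map N f p)) =
      subst_map N0 (\<lambda>z. tensor_assoc (tensor_map \<alpha> \<delta> (f z))) p" if "clinear f" for f and p :: "'a poly"
    using that by (intro subst_map_intertwine[where h = "\<lambda>t. tensor_assoc (tensor_map \<alpha> \<delta> t)"]
        coassoc_right_N coassoc_right_linear N_linear N_tensor2_linear)
  then show ?thesis
    by (subst coboundary_eq[of a])
      (simp add: clinear_sum[OF coassoc_right_linear] clinear_add[OF coassoc_right_linear] linear_simps
        coassoc_right_tensor subst_map_sum_fun subst_map_add_fun clinear_sum_fun dsum_def term_defs sum.distrib)
qed

lemma coassoc_left_eq:
  "tensor_map \<delta> \<alpha> (\<delta> a) = dsum (E5 a) + dsum (E6 a) + dsum (E7 a) + dsum (E8 a)"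
proof -
  have "tensor_map \<delta> \<alpha> (subst_map N f p) =
      subst_map N0 (\<lambda>z. tensor_map \<delta> \<alpha> (f z)) p" if "clinear f" for f and p :: "'a poly"
    using that by (intro subst_map_intertwine[where h = "tensor_map \<delta> \<alpha>"]
        coassoc_left_N coassoc_left_linear N_linear N_tensor2_linear)
  then show ?thesis
    by (subst coboundary_eq[of a])
      (simp add: clinear_sum[OF coassoc_left_linear] clinear_add[OF coassoc_left_linear] linear_simps
        coassoc_left_tensor subst_map_sum_fun subst_map_add_fun clinear_sum_fun dsum_def term_defs sum.distrib)
qed

text \<open>\<open>M3\<close>, ..., \<open>M6\<close> arise from Q(a)[[r,r]] and, negated, from M.
  In X the terms \<open>E3\<close> and \<open>E6\<close> leave \<open>Z1 - M2\<close>, as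
  \<open>Z2\<close> drops out; \<open>-Z1\<close> also comes from Q(a)[[r,r]] and \<open>M2\<close>
  from M. The sum \<open>B5\<close>, which has no partner in [[r,r]], is antisymmetrised by skew
  symmetry and Jacobi after a acts.\<close>

lemma J_obstruction_eq:
  defines "X a \<equiv> tensor_assoc (tensor_map \<alpha> \<delta> (\<delta> a)) - tensor_map \<delta> \<alpha> (\<delta> a)"
  shows "J_obstruction D \<alpha> lp I u v a = - (X a - tau12 (X a))"
  unfolding J_obstruction_def Q_part_eq rr_bracket_eq M_term_eq M_half_eq X_def coassoc_right_eq coassoc_left_eq
  by (simp add: Q_linear[THEN clinear_add] Q_linear[THEN clinear_diff] Q_tau12 dsum_Q dsum_E3 dsum_E6 dsum_Z3
      clinear_add[OF tau12_linear] clinear_diff[OF tau12_linear] clinear_minus[OF tau12_linear] algebra_simps)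

lemma coalgebra_iff:
  "hom_left_symmetric_conformal_coalgebra D \<delta> \<alpha> \<longleftrightarrow> (\<forall>a. J_obstruction D \<alpha> lp I u v a = 0)"
proof -
  have "J_obstruction D \<alpha> lp I u v a = 0 \<longleftrightarrow>
      tensor_assoc (tensor_map \<alpha> \<delta> (\<delta> a)) - tau12 (tensor_assoc (tensor_map \<alpha> \<delta> (\<delta> a)))
        = tensor_map \<delta> \<alpha> (\<delta> a) - tau12 (tensor_map \<delta> \<alpha> (\<delta> a))" for a
    unfolding J_obstruction_eq by (auto simp: clinear_diff[OF tau12_linear] algebra_simps)
  then show ?thesis
    unfolding hom_left_symmetric_conformal_coalgebra_def
    by (simp add: linear_D linear_alpha alpha_D coboundary_linear coboundary_D)
qed

end

theorem proposition4p8: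
  fixes D \<alpha> :: "'a::complex_vector \<Rightarrow> 'a" and lp :: "'a \<Rightarrow> 'a \<Rightarrow> 'a poly"
    and I :: "'i set" and u v :: "'i \<Rightarrow> 'a" and r :: "'a \<otimes> 'a"
  assumes "hom_left_symmetric_conformal_algebra D \<alpha> lp"
    and "finite I"
    and "r = (\<Sum>i\<in>I. u i \<otimes> v i)"
    and "tensor_map \<alpha> \<alpha> r = r"
  shows "hom_left_symmetric_conformal_coalgebra D (coboundary D \<alpha> lp r) \<alpha>
    \<longleftrightarrow> (\<forall>a. J_obstruction D \<alpha> lp I u v a = 0)"
proof -
  interpret invariant_tensor D \<alpha> lp I u v
    using assms by (simp add: invariant_tensor_def invariant_tensor_axioms_def)
  show ?thesis
    unfolding assms(3) by (rule coalgebra_iff)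
qed

end
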